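(* Let $1\le n\le 3$, $0<\alpha\le 1$, $\rho_\pm>0$ and $u_->u_+$. For $A,B>0$ with $(\rho_+,u_+)\in S_1S_2^{AB}(\rho_-,u_-)$, let $(\rho^{AB},u^{AB})$ be the two-shock Riemann solution of the extended Chaplygin gas equations with Riemann data $(\rho_\pm,u_\pm)$. Then, as $A,B\to 0$, $\rho^{AB}$ and $\rho^{AB}u^{AB}$ converge in the sense of distributions, and the limits of $\rho^{AB}$ and $\rho^{AB}u^{AB}$ are each the sum of a step function and a $\delta$-measure supported on $S=\{(\sigma t,t): t\ge 0\}$ with weights $$w_1(t)=\frac{t}{\sqrt{1+\sigma^2}}(\sigma[\rho]-[\rho u])\quad\text{and}\quad w_2(t)=\frac{t}{\sqrt{1+\sigma^2}}(\sigma[\rho u]-[\rho u^2]),$$ respectively. That is, for every $\phi\in C_0^\infty(\mathbb{R}\times[0,\infty))$, $$\lim_{A,B\to0}\int_0^\infty\!\!\int_{-\infty}^\infty \rho^{AB}\phi\,dx\,dt=\int_0^\infty\!\!\int_{-\infty}^\infty \rho_0(x-\sigma t)\phi\,dx\,dt+\langle w_1\delta_S,\phi\rangle,$$ $$\lim_{A,B\to0}\int_0^\infty\!\!\int_{-\infty}^\infty \rho^{AB}u^{AB}\phi\,dx\,dt=\int_0^\infty\!\!\int_{-\infty}^\infty (\rho_0u_0)(x-\sigma t)\phi\,dx\,dt+\langle w_2\delta_S,\phi\rangle.$$ These limits form a $\delta$-shock solution of the transport equations $\rho_t+(\rho u)_x=0$, $(\rho u)_t+(\rho u^2)_x=0$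 with the same Riemann data $(\rho_\pm,u_\pm)$.
   Context: For $A,B>0$, the extended Chaplygin gas equations are $\rho_t+(\rho u)_x=0$, $(\rho u)_t+(\rho u^2+P)_x=0$ with $P=A\rho^n-B\rho^{-\alpha}$; Riemann data means $(\rho,u)(x,0)=(\rho_\pm,u_\pm)$ for $\pm x>0$. For $a,b>0$ put $$\Phi_{AB}(a,b)=\sqrt{\frac{a-b}{ab}\Big(A(a^n-b^n)-B\big(\tfrac1{a^\alpha}-\tfrac1{b^\alpha}\big)\Big)}.$$ The region $S_1S_2^{AB}(\rho_-,u_-)$ is the set of $(\rho,u)$, $\rho>0$, with $u-u_-<-\Phi_{AB}(\rho,\rho_-)$ (the part of the phase plane where the Riemann solution consists of a 1-shock followed by a 2-shock). If $u_+<u_-$ it contains $(\rho_+,u_+)$ for all sufficiently small $A,B>0$. For $(\rho_+,u_+)$ in this region, the two-shock Riemann solution is, with $\xi=x/t$, equal to $(\rho_-,u_-)$ for $\xi<\sigma_1^{AB}$, $(\rho_*^{AB},u_*^{AB})$ for $\sigma_1^{AB}<\xi<\sigma_2^{AB}$, and $(\rho_+,u_+)$ for $\xi>\sigma_2^{AB}$, where $\rho_*^{AB}>\max\{\rho_-,\rho_+\}$, $u_*^{AB}-u_-=-\Phi_{AB}(\rho_*^{AB},\rho_-)$, $u_+-u_*^{AB}=-\Phi_{AB}(\rho_+,\rho_*^{AB})$, $\sigma_1^{AB}=\frac{\rho_*^{AB}u_*^{AB}-\rho_-u_-}{\rho_*^{AB}-\rho_-}$, $\sigma_2^{AB}=\frac{\rho_+u_+-\rho_*^{AB}u_*^{AB}}{\rho_+-\rho_*^{AB}}$.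 "$A,B\to0$" means $(A,B)\to(0,0)$ with $A,B>0$. Notation: $[q]=q_+-q_-$ (e.g. $[\rho u]=\rho_+u_+-\rho_-u_-$), and $$\sigma=\frac{\sqrt{\rho_-}\,u_-+\sqrt{\rho_+}\,u_+}{\sqrt{\rho_-}+\sqrt{\rho_+}}.$$ With $H$ the Heaviside function, $\rho_0(y)=\rho_-+[\rho]H(y)$, $(\rho_0u_0)(y)=\rho_-u_-+[\rho u]H(y)$, $(\rho_0u_0^2)(y)=\rho_-u_-^2+[\rho u^2]H(y)$. For a smooth curve $S=\{(x(s),t(s)):a\le s\le b\}$ the weighted $\delta$-measure $w\delta_S$ is $\langle w\delta_S,\psi\rangle=\int_a^b w(s)\psi(x(s),t(s))\sqrt{x'(s)^2+t'(s)^2}\,ds$; here $S$ is parametrized by $t$. That the limits form a $\delta$-shock solution of the transport equations means: the velocity on $S$ is $u_\delta=\sigma$, and for all $\psi\in C_0^\infty(\mathbb{R}\times\mathbb{R}_+)$ one has $\langle\rho,\psi_t\rangle+\langle\rho u,\psi_x\rangle=0$ and $\langle\rho u,\psi_t\rangle+\langle\rho u^2,\psi_x\rangle=0$, where $\langle\rho,\psi\rangle=\int_0^\infty\!\int_{-\infty}^{\infty}\rho_0(x-\sigma t)\psi\,dx\,dt+\langle w_1\delta_S,\psi\rangle$, $\langle\rho u,\psi\rangle=\int_0^\infty\!\int_{-\infty}^{\infty}(\rho_0u_0)(x-\sigma t)\psi\,dx\,dt+\langle w_2\delta_S,\psi\rangle$, $\langle\rho u^2,\psi\rangle=\int_0^\infty\!\int_{-\infty}^{\infty}(\rho_0u_0^2)(x-\sigma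 t)\psi\,dx\,dt+\langle \sigma w_2\delta_S,\psi\rangle$. *)

theory Defs
  imports "HOL-Analysis.Analysis"
begin

text \<open>Points of the \<open>(x, t)\<close>-plane and of the \<open>(\<rho>, u)\<close>-phase plane are pairs of reals.
  The equations are
  \<open>\<rho>\<^sub>t + (\<rho> u)\<^sub>x = 0\<close>, \<open>(\<rho> u)\<^sub>t + (\<rho> u\<^sup>2 + P)\<^sub>x = 0\<close> with \<open>P = A \<rho>\<^sup>n - B / \<rho>\<^sup>\<alpha>\<close> and real exponents \<open>n\<close>, \<open>\<alpha>\<close>;
  by the Rankine-Hugoniot conditions \<open>shock_Phi\<close> is the velocity drop across a shock joining the
  densities \<open>a\<close> and \<open>b\<close>.\<close>

definition shock_Phi :: "real \<Rightarrow> real \<Rightarrow> real \<Rightarrow> real \<Rightarrow> real \<Rightarrow> real \<Rightarrow> real" where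
  "shock_Phi n \<alpha> A B a b =
     sqrt ((a - b) / (a * b) *
       (A * (a powr n - b powr n) - B * (1 / a powr \<alpha> - 1 / b powr \<alpha>)))"

definition S1S2_region :: "real \<Rightarrow> real \<Rightarrow> real \<Rightarrow> real \<Rightarrow> real \<Rightarrow> real \<Rightarrow> (real \<times> real) set" where
  "S1S2_region n \<alpha> A B rho_m u_m =
     {(rho, u). rho > 0 \<and> u - u_m < - shock_Phi n \<alpha> A B rho rho_m}"

definition is_intermediate_state ::
  "real \<Rightarrow> real \<Rightarrow> real \<Rightarrow> real \<Rightarrow> real \<Rightarrow> real \<Rightarrow> real \<Rightarrow> real \<Rightarrow> real \<Rightarrow> real \<Rightarrow> bool" where
  "is_intermediate_state n \<alpha> A B rho_m u_m rho_p u_p rho_s u_s \<longleftrightarrow>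
     rho_s > max rho_m rho_p \<and>
     u_s - u_m = - shock_Phi n \<alpha> A B rho_s rho_m \<and>
     u_p - u_s = - shock_Phi n \<alpha> A B rho_p rho_s"

text \<open>Rankine-Hugoniot speed of a shock between \<open>(r1, v1)\<close> (left) and \<open>(r2, v2)\<close> (right).\<close>

definition shock_speed :: "real \<Rightarrow> real \<Rightarrow> real \<Rightarrow> real \<Rightarrow> real" where
  "shock_speed r1 v1 r2 v2 = (r2 * v2 - r1 * v1) / (r2 - r1)"

text \<open>The values of \<open>\<rho>\<close> and \<open>u\<close> on the two shock lines and for \<open>t \<le> 0\<close> are left unspecified.\<close>

definition is_two_shock_solution ::
  "real \<Rightarrow> real \<Rightarrow> real \<Rightarrow> real \<Rightarrow> real \<Rightarrow> real \<Rightarrow> real \<Rightarrow> real \<Rightarrow>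
   (real \<times> real \<Rightarrow> real) \<Rightarrow> (real \<times> real \<Rightarrow> real) \<Rightarrow> bool" where
  "is_two_shock_solution n \<alpha> A B rho_m u_m rho_p u_p rho u \<longleftrightarrow>
     (\<exists>rho_s u_s. is_intermediate_state n \<alpha> A B rho_m u_m rho_p u_p rho_s u_s \<and>
        (let \<sigma>1 = shock_speed rho_m u_m rho_s u_s;
             \<sigma>2 = shock_speed rho_s u_s rho_p u_p
         in \<forall>x t. t > 0 \<longrightarrow>
              (x / t < \<sigma>1 \<longrightarrow> rho (x, t) = rho_m \<and> u (x, t) = u_m) \<and>
              (\<sigma>1 < x / t \<and> x / t < \<sigma>2 \<longrightarrow> rho (x, t) = rho_s \<and> u (x, t) = u_s) \<and>
              (\<sigma>2 < x / t \<longrightarrow> rho (x, t) = rho_p \<and> u (x, t) = u_p)))"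

text \<open>\<open>Ck_on k U f\<close>: \<open>f\<close> is of class \<open>C\<^sup>k\<close> on the open set \<open>U\<close>.\<close>

primrec Ck_on :: "nat \<Rightarrow> 'a::euclidean_space set \<Rightarrow> ('a \<Rightarrow> real) \<Rightarrow> bool" where
  "Ck_on 0 U f \<longleftrightarrow> continuous_on U f"
| "Ck_on (Suc k) U f \<longleftrightarrow>
     (\<forall>p\<in>U. f differentiable (at p)) \<and>
     (\<forall>v. Ck_on k U (\<lambda>p. frechet_derivative f (at p) v))"

text \<open>\<open>C\<^sub>0\<^sup>\<infinity>(\<Omega>)\<close>, also for non-open \<open>\<Omega>\<close> such as \<open>\<real> \<times> [0, \<infinity>)\<close>, where smoothness up to the
  boundary means that there is a smooth extension to an open neighbourhood; test functions need
  not vanish on the part of the boundary that belongs to \<open>\<Omega>\<close>. Only the values of \<open>\<phi>\<close> on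
  \<open>\<Omega>\<close> matter.\<close>

definition test_function_on :: "(real \<times> real) set \<Rightarrow> (real \<times> real \<Rightarrow> real) \<Rightarrow> bool" where
  "test_function_on \<Omega> \<phi> \<longleftrightarrow>
     (\<exists>U g. open U \<and> \<Omega> \<subseteq> U \<and> (\<forall>k. Ck_on k U g) \<and> (\<forall>p\<in>\<Omega>. \<phi> p = g p)) \<and>
     (\<exists>K. compact K \<and> K \<subseteq> \<Omega> \<and> (\<forall>p\<in>\<Omega> - K. \<phi> p = 0))"

abbreviation closed_half_plane :: "(real \<times> real) set" where
  "closed_half_plane \<equiv> UNIV \<times> {0..}"

abbreviation open_half_plane :: "(real \<times> real) set" where
  "open_half_plane \<equiv> UNIV \<times> {0<..}"

definition d_x :: "(real \<times> real \<Rightarrow> real) \<Rightarrow> real \<times> real \<Rightarrow> real" where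
  "d_x \<psi> = (\<lambda>(x, t). deriv (\<lambda>y. \<psi> (y, t)) x)"

definition d_t :: "(real \<times> real \<Rightarrow> real) \<Rightarrow> real \<times> real \<Rightarrow> real" where
  "d_t \<psi> = (\<lambda>(x, t). deriv (\<lambda>s. \<psi> (x, s)) t)"

definition fun_pairing :: "(real \<times> real \<Rightarrow> real) \<Rightarrow> (real \<times> real \<Rightarrow> real) \<Rightarrow> real" where
  "fun_pairing f \<psi> = (LINT t:{0<..}|lborel. (LINT x|lborel. f (x, t) * \<psi> (x, t)))"

text \<open>The weighted \<open>\<delta>\<close>-measure on the curve \<open>s \<mapsto> (X s, T s)\<close>, \<open>s \<in> I\<close>.\<close>

definition delta_pairing ::
  "real set \<Rightarrow> (real \<Rightarrow> real) \<Rightarrow> (real \<Rightarrow> real) \<Rightarrow> (real \<Rightarrow> real) \<Rightarrow>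
   (real \<times> real \<Rightarrow> real) \<Rightarrow> real" where
  "delta_pairing I X T w \<psi> =
     (LINT s:I|lborel. w s * \<psi> (X s, T s) * sqrt ((deriv X s)\<^sup>2 + (deriv T s)\<^sup>2))"

definition Heaviside :: "real \<Rightarrow> real" where
  "Heaviside y = (if 0 \<le> y then 1 else 0)"

definition step_fun :: "real \<Rightarrow> real \<Rightarrow> real \<Rightarrow> real" where
  "step_fun q_m q_p y = q_m + (q_p - q_m) * Heaviside y"

text \<open>The step function with states \<open>q_m\<close>, \<open>q_p\<close> across \<open>x = \<sigma> t\<close> plus the \<open>\<delta>\<close>-measure of
  weight \<open>w\<close> on \<open>S = {(\<sigma> t, t). t \<ge> 0}\<close>, parametrized by \<open>t\<close>.\<close>

definition step_delta_pairing ::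
  "real \<Rightarrow> real \<Rightarrow> real \<Rightarrow> (real \<Rightarrow> real) \<Rightarrow> (real \<times> real \<Rightarrow> real) \<Rightarrow> real" where
  "step_delta_pairing \<sigma> q_m q_p w \<psi> =
     fun_pairing (\<lambda>(x, t). step_fun q_m q_p (x - \<sigma> * t)) \<psi> +
     delta_pairing {0..} (\<lambda>t. \<sigma> * t) (\<lambda>t. t) w \<psi>"

text \<open>\<open>\<delta>\<close>-shock solutions of the transport equations \<open>\<rho>\<^sub>t + (\<rho> u)\<^sub>x = 0\<close>,
  \<open>(\<rho> u)\<^sub>t + (\<rho> u\<^sup>2)\<^sub>x = 0\<close> with Riemann data \<open>(rho_m, u_m)\<close>,
  \<open>(rho_p, u_p)\<close>: \<open>\<sigma>\<close> is the slope of the curve \<open>S\<close>, \<open>u_delta\<close> the velocity on \<open>S\<close>, and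
  \<open>w1\<close>, \<open>w2\<close> are the weights of \<open>\<rho>\<close> and \<open>\<rho> u\<close> on \<open>S\<close>.\<close>

definition is_delta_shock_solution ::
  "real \<Rightarrow> real \<Rightarrow> real \<Rightarrow> real \<Rightarrow> real \<Rightarrow> real \<Rightarrow> (real \<Rightarrow> real) \<Rightarrow> (real \<Rightarrow> real) \<Rightarrow> bool" where
  "is_delta_shock_solution rho_m u_m rho_p u_p \<sigma> u_delta w1 w2 \<longleftrightarrow>
     u_delta = \<sigma> \<and>
     (\<forall>\<psi>. test_function_on open_half_plane \<psi> \<longrightarrow>
        step_delta_pairing \<sigma> rho_m rho_p w1 (d_t \<psi>) +
        step_delta_pairing \<sigma> (rho_m * u_m) (rho_p * u_p) w2 (d_x \<psi>) = 0 \<and>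
        step_delta_pairing \<sigma> (rho_m * u_m) (rho_p * u_p) w2 (d_t \<psi>) +
        step_delta_pairing \<sigma> (rho_m * u_m\<^sup>2) (rho_p * u_p\<^sup>2) (\<lambda>t. u_delta * w2 t) (d_x \<psi>) = 0)"

definition sigma_delta :: "real \<Rightarrow> real \<Rightarrow> real \<Rightarrow> real \<Rightarrow> real" where
  "sigma_delta rho_m u_m rho_p u_p =
     (sqrt rho_m * u_m + sqrt rho_p * u_p) / (sqrt rho_m + sqrt rho_p)"

lemma shock_Phi_pos:
  assumes "n \<ge> 1" "\<alpha> > 0" "A > 0" "B > 0" "a > b" "b > 0"
  shows "shock_Phi n \<alpha> A B a b > 0"
proof -
  have "b powr n < a powr n" using assms by (simp add: powr_less_mono2)
  moreover have "b powr \<alpha> < a powr \<alpha>" using assms by (simp add: powr_less_mono2)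
  then have "1 / a powr \<alpha> < 1 / b powr \<alpha>" using assms by (simp add: frac_less2)
  ultimately have "A * (a powr n - b powr n) > 0" "B * (1 / a powr \<alpha> - 1 / b powr \<alpha>) < 0"
    using assms by (simp_all add: mult_pos_neg)
  moreover have "(a - b) / (a * b) > 0" using assms by simp
  ultimately show ?thesis unfolding shock_Phi_def
    by (simp only: real_sqrt_gt_0_iff) (rule mult_pos_pos; linarith)
qed

lemma shock_Phi_sym: "shock_Phi n \<alpha> A B a b = shock_Phi n \<alpha> A B b a"
proof -
  have "(a - b) / (a * b) * (A * (a powr n - b powr n) - B * (1 / a powr \<alpha> - 1 / b powr \<alpha>)) =
        (b - a) / (b * a) * (A * (b powr n - a powr n) - B * (1 / b powr \<alpha> - 1 / a powr \<alpha>))"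
    by (simp add: divide_inverse) algebra
  then show ?thesis by (simp only: shock_Phi_def)
qed

lemma shock_Phi_refl: "shock_Phi n \<alpha> A B a a = 0"
  by (simp add: shock_Phi_def)

lemma shock_Phi_nonneg:
  assumes "n \<ge> 1" "\<alpha> > 0" "A > 0" "B > 0" "a > 0" "b > 0"
  shows "shock_Phi n \<alpha> A B a b \<ge> 0"
  using shock_Phi_pos[OF assms(1-4), of a b] shock_Phi_pos[OF assms(1-4), of b a] assms
    shock_Phi_sym[of n \<alpha> A B a b] shock_Phi_refl[of n \<alpha> A B a]
  by (cases a b rule: linorder_cases) auto

lemma intermediate_state_exists:
  assumes "n \<ge> 1" "\<alpha> > 0" "A > 0" "B > 0" "rho_m > 0"
    and reg: "(rho_p, u_p) \<in> S1S2_region n \<alpha> A B rho_m u_m"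
  shows "\<exists>rho_s u_s. is_intermediate_state n \<alpha> A B rho_m u_m rho_p u_p rho_s u_s"
proof -
  define D where "D = u_m - u_p"
  define M where "M = max rho_m rho_p"
  define \<Phi> where "\<Phi> = shock_Phi n \<alpha> A B"
  define f where "f r = \<Phi> r rho_m + \<Phi> rho_p r" for r
  have rp: "rho_p > 0" and D: "\<Phi> rho_p rho_m < D"
    using reg by (auto simp: S1S2_region_def D_def \<Phi>_def)
  have nonneg: "a > 0 \<Longrightarrow> b > 0 \<Longrightarrow> \<Phi> a b \<ge> 0" for a b
    unfolding \<Phi>_def using assms by (intro shock_Phi_nonneg)
  have D0: "D > 0" using nonneg[OF rp assms(5)] D by linarith
  have M0: "M > 0" using assms rp by (simp add: M_def)
  have fM: "f M < D"
    using D shock_Phi_refl shock_Phi_sym[of n \<alpha> A B rho_p rho_m]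
    by (cases "rho_m \<le> rho_p") (auto simp: f_def M_def \<Phi>_def shock_Phi_refl max_def)
  define R where "R = max (max 1 M) (max (2 * rho_m) (rho_m powr n + 2 * rho_m * D\<^sup>2 / A))"
  have R: "R \<ge> 1" "R \<ge> M" "R \<ge> 2 * rho_m" "R \<ge> rho_m powr n + 2 * rho_m * D\<^sup>2 / A"
    by (simp_all add: R_def)
  have "f R \<ge> D"
  proof -
    have Rn: "R \<le> R powr n" using R assms powr_mono[of 1 n R] by simp
    have "rho_m powr \<alpha> \<le> R powr \<alpha>" using R assms by (intro powr_mono2) auto
    then have "1 / R powr \<alpha> \<le> 1 / rho_m powr \<alpha>" using assms by (simp add: frac_le)
    then have "B * (1 / R powr \<alpha> - 1 / rho_m powr \<alpha>) \<le> 0"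
      using assms by (simp add: mult_nonneg_nonpos)
    moreover have "A * (R powr n - rho_m powr n) \<ge> A * (2 * rho_m * D\<^sup>2 / A)"
      using R Rn assms by (intro mult_left_mono) auto
    then have "A * (R powr n - rho_m powr n) \<ge> 2 * rho_m * D\<^sup>2" using assms by simp
    ultimately have 1: "A * (R powr n - rho_m powr n) - B * (1 / R powr \<alpha> - 1 / rho_m powr \<alpha>)
        \<ge> 2 * rho_m * D\<^sup>2" by linarith
    have 2: "(R - rho_m) / (R * rho_m) \<ge> 1 / (2 * rho_m)"
      using R assms by (simp add: field_simps)
    have "1 / (2 * rho_m) * (2 * rho_m * D\<^sup>2) \<le> (R - rho_m) / (R * rho_m) *
        (A * (R powr n - rho_m powr n) - B * (1 / R powr \<alpha> - 1 / rho_m powr \<alpha>))"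
      using 1 2 assms by (intro mult_mono order_trans[OF _ 2]) auto
    then have "D\<^sup>2 \<le> (R - rho_m) / (R * rho_m) *
        (A * (R powr n - rho_m powr n) - B * (1 / R powr \<alpha> - 1 / rho_m powr \<alpha>))"
      using assms by simp
    then have "D \<le> \<Phi> R rho_m" unfolding \<Phi>_def shock_Phi_def by (rule real_le_rsqrt)
    then show ?thesis using nonneg[OF rp, of R] R unfolding f_def by simp
  qed
  moreover have "continuous_on {M..R} f"
    unfolding f_def \<Phi>_def shock_Phi_def using M0 assms rp
    by (intro continuous_intros) auto
  ultimately obtain r where r: "M \<le> r" "r \<le> R" "f r = D"
    using IVT'[of f M D R] fM R by auto
  then have "r > M" using fM by (cases "r = M") auto
  then have "is_intermediate_state n \<alpha> A B rho_m u_m rho_p u_p r (u_m - \<Phi> r rho_m)"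
    using r(3) by (auto simp: is_intermediate_state_def M_def f_def D_def \<Phi>_def)
  then show ?thesis by blast
qed

text \<open>Two-shock solutions exist for all data in the region; in particular the two constraints on
  the speeds in \<open>is_two_shock_solution\<close> never conflict.\<close>

lemma two_shock_solution_exists:
  assumes "n \<ge> 1" "\<alpha> > 0" "A > 0" "B > 0" "rho_m > 0"
    and reg: "(rho_p, u_p) \<in> S1S2_region n \<alpha> A B rho_m u_m"
  shows "\<exists>rho u. is_two_shock_solution n \<alpha> A B rho_m u_m rho_p u_p rho u"
proof -
  obtain rs us where s: "is_intermediate_state n \<alpha> A B rho_m u_m rho_p u_p rs us"
    using intermediate_state_exists[OF assms] by blast
  have rp: "rho_p > 0" using reg by (auto simp: S1S2_region_def)
  have gt: "rs > rho_m" "rs > rho_p" using s by (auto simp: is_intermediate_state_def)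
  have um: "us < u_m"
    using s shock_Phi_pos[OF assms(1-4) gt(1)] assms(5)
    by (auto simp: is_intermediate_state_def)
  have up: "u_p < us"
    using s shock_Phi_pos[OF assms(1-4) gt(2)] rp shock_Phi_sym[of n \<alpha> A B rho_p rs]
    by (auto simp: is_intermediate_state_def)
  define s1 where "s1 = shock_speed rho_m u_m rs us"
  define s2 where "s2 = shock_speed rs us rho_p u_p"
  have "s1 < us"
  proof -
    have "rho_m * us < rho_m * u_m" using um assms by simp
    then show ?thesis unfolding s1_def shock_speed_def using gt
      by (simp add: divide_less_eq algebra_simps)
  qed
  moreover have "us < s2"
  proof -
    have "rho_p * u_p < rho_p * us" using up rp by simp
    then show ?thesis unfolding s2_def shock_speed_def using gt
      by (simp add: less_divide_eq algebra_simps)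
  qed
  ultimately have lt: "s1 < s2" by linarith
  define rho where "rho p = (if fst p / snd p < s1 then rho_m
      else if fst p / snd p < s2 then rs else rho_p)" for p :: "real \<times> real"
  define u where "u p = (if fst p / snd p < s1 then u_m
      else if fst p / snd p < s2 then us else u_p)" for p :: "real \<times> real"
  have "is_two_shock_solution n \<alpha> A B rho_m u_m rho_p u_p rho u"
    unfolding is_two_shock_solution_def Let_def
    using s lt by (intro exI[of _ rs] exI[of _ us])
      (auto simp: rho_def u_def s1_def[symmetric] s2_def[symmetric])
  then show ?thesis by blast
qed

end

theory Submission
  imports Defs
begin

text \<open>By the Rankine-Hugoniot relations each shock satisfies
  \<open>\<rho>\<^sub>\<plusminus> \<Phi>\<^sup>2 = (1 - \<rho>\<^sub>\<plusminus> / \<rho>\<^sub>*) (A \<rho>\<^sub>*\<^sup>n + o(1))\<close>. Since the two velocity drops add up to \<open>u\<^sub>- - u\<^sub>+ > 0\<close>,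
  the intermediate density tends to infinity, and comparing the two relations forces
  \<open>u\<^sub>* \<rightarrow> \<sigma>\<close>. Both shock speeds then tend to \<open>\<sigma>\<close>, while the jump conditions give
  \<open>\<rho>\<^sub>* (\<sigma>\<^sub>2 - \<sigma>\<^sub>1) \<rightarrow> \<sigma> [\<rho>] - [\<rho> u]\<close>, the mass per unit time carried by the delta measure; dominated
  convergence turns this into convergence of distributions. The momentum weight is \<open>\<sigma>\<close> times the
  mass weight because \<open>\<sigma>\<^sup>2 [\<rho>] - 2 \<sigma> [\<rho> u] + [\<rho> u\<^sup>2] = 0\<close>, so both transport equations are instances
  of one conservation law, verified by integrating by parts in the coordinates \<open>(x - \<sigma> t, t)\<close>.\<close>

section \<open>Asymptotics of the intermediate state and of the two shock speeds\<close>

lemma shock_Phi_square: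
  assumes "n \<ge> 1" "\<alpha> > 0" "A > 0" "B > 0" "r > b" "b > 0"
  shows "b * (shock_Phi n \<alpha> A B r b)\<^sup>2 =
    (1 - b / r) * (A * (r powr n - b powr n) - B * (1 / r powr \<alpha> - 1 / b powr \<alpha>))"
proof -
  have "b powr n < r powr n" using assms by (simp add: powr_less_mono2)
  moreover have "b powr \<alpha> < r powr \<alpha>" using assms by (simp add: powr_less_mono2)
  then have "1 / r powr \<alpha> < 1 / b powr \<alpha>" using assms by (simp add: frac_less2)
  ultimately have "A * (r powr n - b powr n) > 0" "B * (1 / r powr \<alpha> - 1 / b powr \<alpha>) < 0"
    using assms by (simp_all add: mult_pos_neg)
  moreover have "(r - b) / (r * b) > 0" using assms by simp
  ultimately have "(r - b) / (r * b) * (A * (r powr n - b powr n) - B * (1 / r powr \<alpha> - 1 / b powr \<alpha>)) \<ge> 0"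
    by (intro mult_nonneg_nonneg) linarith+
  then have "(shock_Phi n \<alpha> A B r b)\<^sup>2 =
      (r - b) / (r * b) * (A * (r powr n - b powr n) - B * (1 / r powr \<alpha> - 1 / b powr \<alpha>))"
    unfolding shock_Phi_def by (rule real_sqrt_pow2)
  moreover have "b * ((r - b) / (r * b)) = 1 - b / r" using assms by (simp add: field_simps)
  ultimately show ?thesis by (metis mult.assoc)
qed

text \<open>The limit at (0, 0) will be tested along arbitrary sequences of positive parameters. For
  each index one intermediate state is fixed, and its asymptotics are derived here.\<close>

context
  fixes n \<alpha> rho_m u_m rho_p u_p :: real and A B rs us :: "nat \<Rightarrow> real"
  assumes n: "n \<ge> 1" and \<alpha>: "\<alpha> > 0" and rho: "rho_m > 0" "rho_p > 0" and u: "u_m > u_p"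
    and A: "\<And>k. A k > 0" "A \<longlonglongrightarrow> 0" and B: "\<And>k. B k > 0" "B \<longlonglongrightarrow> 0"
    and s: "\<And>k. is_intermediate_state n \<alpha> (A k) (B k) rho_m u_m rho_p u_p (rs k) (us k)"
begin

private lemma rs: "rs k > rho_m" "rs k > rho_p" "rs k > 0"
  using s[of k] rho by (auto simp: is_intermediate_state_def)

private lemma us:
  "us k = u_m - shock_Phi n \<alpha> (A k) (B k) (rs k) rho_m"
  "us k = u_p + shock_Phi n \<alpha> (A k) (B k) (rs k) rho_p"
  "u_p < us k" "us k < u_m"
  using s[of k] shock_Phi_sym[of n \<alpha> "A k" "B k" "rs k" rho_p]
    shock_Phi_pos[OF n \<alpha> A(1) B(1) rs(1) rho(1), of k k k]
    shock_Phi_pos[OF n \<alpha> A(1) B(1) rs(2) rho(2), of k k k]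
  by (auto simp: is_intermediate_state_def)

text \<open>The part of the Rankine-Hugoniot factor that dies out with \<open>A\<close> and
  \<open>B\<close>. What is left, \<open>A k * rs k powr n\<close>, is the same for both shocks and
  can be eliminated between them.\<close>

private definition E where
  "E b k = A k * b powr n + B k * (1 / rs k powr \<alpha> - 1 / b powr \<alpha>)"

text \<open>Since \<open>rs k > b\<close>, the coefficient of \<open>B k\<close> is bounded by
  \<open>1 / b powr \<alpha>\<close>; the limit is therefore available before anything is known
  about the growth of \<open>rs\<close>.\<close>

private lemma E_tendsto:
  assumes "b > 0" "b \<in> {rho_m, rho_p}"
  shows "E b \<longlonglongrightarrow> 0"
proof -
  have "(\<lambda>k. B k * (1 / rs k powr \<alpha> - 1 / b powr \<alpha>)) \<longlonglongrightarrow> 0"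
  proof (rule Lim_null_comparison[where g = "\<lambda>k. B k * (1 / b powr \<alpha>)"])
    have "norm (B k * (1 / rs k powr \<alpha> - 1 / b powr \<alpha>)) \<le> B k * (1 / b powr \<alpha>)" for k
    proof -
      have "b powr \<alpha> < rs k powr \<alpha>" using assms rs \<alpha> by (auto simp: powr_less_mono2)
      then have "1 / rs k powr \<alpha> < 1 / b powr \<alpha>" using assms by (simp add: frac_less2)
      moreover have "1 / rs k powr \<alpha> \<ge> 0" by simp
      ultimately have "\<bar>1 / rs k powr \<alpha> - 1 / b powr \<alpha>\<bar> \<le> 1 / b powr \<alpha>" by linarith
      then show ?thesis using B(1)[of k] unfolding real_norm_def abs_mult
        by (simp only: abs_of_pos mult_left_mono less_imp_le)
    qed
    then show "\<forall>\<^sub>F k in sequentially. norm (B k * (1 / rs k powr \<alpha> - 1 / b powr \<alpha>)) \<le> B k * (1 / b powr \<alpha>)"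
      by simp
    show "(\<lambda>k. B k * (1 / b powr \<alpha>)) \<longlonglongrightarrow> 0"
      by (rule tendsto_mult_left_zero[OF B(2)])
  qed
  moreover have "(\<lambda>k. A k * b powr n) \<longlonglongrightarrow> 0"
    by (rule tendsto_mult_left_zero[OF A(2)])
  ultimately show ?thesis unfolding E_def using tendsto_add by fastforce
qed

private lemma Phi_square:
  assumes "b \<in> {rho_m, rho_p}"
  shows "b * (shock_Phi n \<alpha> (A k) (B k) (rs k) b)\<^sup>2 = (1 - b / rs k) * (A k * rs k powr n - E b k)"
  using shock_Phi_square[OF n \<alpha> A(1) B(1), of b "rs k" k k] assms rs[of k] rho
  by (auto simp: E_def algebra_simps)

text \<open>While \<open>rs k \<le> Z\<close>, the term \<open>A k * rs k powr n\<close> is at most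
  \<open>A k * Z powr n\<close>, which tends to 0. For late \<open>k\<close> each velocity drop
  would then be less than half of \<open>u_m - u_p\<close>, although the two drops add up to
  it.\<close>

lemma intermediate_density_tendsto: "filterlim rs at_top sequentially"
  unfolding filterlim_at_top
proof
  fix Z
  define c where "c = (u_m - u_p) / 2"
  have c: "c > 0" using u by (simp add: c_def)
  have small: "\<forall>\<^sub>F k in sequentially. rs k \<le> Z \<longrightarrow> shock_Phi n \<alpha> (A k) (B k) (rs k) b < c"
    if b: "b \<in> {rho_m, rho_p}" for b
  proof -
    have b0: "b > 0" using b rho by auto
    have "(\<lambda>k. A k * Z powr n - E b k) \<longlonglongrightarrow> 0 * Z powr n - 0"
      by (intro tendsto_intros A E_tendsto b b0)
    then have "\<forall>\<^sub>F k in sequentially. A k * Z powr n - E b k < b * c\<^sup>2"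
      using b0 c by (intro order_tendstoD) auto
    then show ?thesis
    proof eventually_elim
      case (elim k)
      show ?case
      proof
        assume Z: "rs k \<le> Z"
        have rb: "rs k > b" using b rs[of k] by auto
        \<comment> \<open>The sign of the second factor is read off from the square on the left; it
          is what permits replacing the first factor \<open>1 - b / rs k\<close> by 1.\<close>
        have "b * (shock_Phi n \<alpha> (A k) (B k) (rs k) b)\<^sup>2 \<ge> 0" using b0 by simp
        then have "A k * rs k powr n - E b k \<ge> 0"
          unfolding Phi_square[OF b] using rb b0 by (simp add: zero_le_mult_iff)
        moreover have "A k * rs k powr n \<le> A k * Z powr n"
          using A(1)[of k] Z rs(3)[of k] n by (intro mult_left_mono powr_mono2) auto
        ultimately have "(1 - b / rs k) * (A k * rs k powr n - E b k) \<le> 1 * (A k * Z powr n - E b k)"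
          using b0 rs(3)[of k] by (intro mult_mono) auto
        with elim have "b * (shock_Phi n \<alpha> (A k) (B k) (rs k) b)\<^sup>2 < b * c\<^sup>2"
          unfolding Phi_square[OF b] by simp
        then show "shock_Phi n \<alpha> (A k) (B k) (rs k) b < c"
          using b0 c by (simp add: power2_less_imp_less)
      qed
    qed
  qed
  have "\<forall>\<^sub>F k in sequentially. \<not> rs k \<le> Z"
    using small[of rho_m, simplified] small[of rho_p, simplified]
  proof eventually_elim
    case (elim k)
    then show ?case using us(1,2)[of k] by (auto simp: c_def)
  qed
  then show "\<forall>\<^sub>F k in sequentially. Z \<le> rs k"
    by eventually_elim simp
qed

text \<open>Eliminating \<open>A k * rs k powr n\<close> between the two shocks shows that
  \<open>rho_m * (y k)\<^sup>2 - rho_p * (z k)\<^sup>2\<close> tends to 0. It factors with the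
  square roots \<open>p\<close>, \<open>q\<close>, and the factor \<open>p * y k + q * z k\<close>
  stays away from 0, so \<open>p * y k - q * z k\<close> tends to 0. This is where the square-root
  weights of \<sigma> come from.\<close>

lemma intermediate_velocity_tendsto: "us \<longlonglongrightarrow> sigma_delta rho_m u_m rho_p u_p"
proof -
  define y z where "y k = shock_Phi n \<alpha> (A k) (B k) (rs k) rho_m"
    and "z k = shock_Phi n \<alpha> (A k) (B k) (rs k) rho_p" for k
  define D where "D = u_m - u_p"
  define p q where "p = sqrt rho_m" and "q = sqrt rho_p"
  have pq: "p > 0" "q > 0" "p\<^sup>2 = rho_m" "q\<^sup>2 = rho_p" using rho by (auto simp: p_def q_def)
  have D: "D > 0" using u by (simp add: D_def)
  have yz: "y k + z k = D" "y k \<ge> 0" "z k \<ge> 0" for k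
    using us[of k] by (auto simp: y_def z_def D_def)
  have inv: "(\<lambda>k. 1 / rs k) \<longlonglongrightarrow> 0"
    using tendsto_divide_0[OF tendsto_const filterlim_at_top_imp_at_infinity[OF intermediate_density_tendsto]] .
  \<comment> \<open>Dividing by \<open>1 - b / rs k\<close> isolates the common term exactly, so no
    limit of \<open>A k * rs k powr n\<close> has to be known; \<open>g b k\<close> below is the
    error of dropping that divisor.\<close>
  have P: "b * (shock_Phi n \<alpha> (A k) (B k) (rs k) b)\<^sup>2 / (1 - b / rs k) = A k * rs k powr n - E b k"
    if b: "b \<in> {rho_m, rho_p}" for b k
    unfolding Phi_square[OF b] using b rs[of k] by auto
  define g where "g b k = 1 / (1 - b / rs k) - 1" for b k
  have g: "g b \<longlonglongrightarrow> 0" for b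
  proof -
    have "(\<lambda>k. 1 / (1 - b * (1 / rs k)) - 1) \<longlonglongrightarrow> 1 / (1 - b * 0) - 1"
      by (intro tendsto_intros inv) auto
    then show ?thesis by (simp add: g_def[abs_def])
  qed
  have bound: "\<bar>y k\<bar> \<le> D" "\<bar>z k\<bar> \<le> D" for k using yz[of k] by auto
  have null: "(\<lambda>k. b * (v k)\<^sup>2 * g b k) \<longlonglongrightarrow> 0" if v: "\<And>k. \<bar>v k\<bar> \<le> D" for b v
  proof (rule Lim_null_comparison[where g = "\<lambda>k. \<bar>b\<bar> * D\<^sup>2 * \<bar>g b k\<bar>"])
    show "\<forall>\<^sub>F k in sequentially. norm (b * (v k)\<^sup>2 * g b k) \<le> \<bar>b\<bar> * D\<^sup>2 * \<bar>g b k\<bar>"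
    proof (intro always_eventually allI)
      fix k
      have "(v k)\<^sup>2 \<le> D\<^sup>2" using v[of k] D by (simp add: abs_le_square_iff[symmetric])
      then show "norm (b * (v k)\<^sup>2 * g b k) \<le> \<bar>b\<bar> * D\<^sup>2 * \<bar>g b k\<bar>"
        by (auto simp: abs_mult intro!: mult_right_mono mult_left_mono)
    qed
    show "(\<lambda>k. \<bar>b\<bar> * D\<^sup>2 * \<bar>g b k\<bar>) \<longlonglongrightarrow> 0"
      using tendsto_mult_right_zero[OF tendsto_rabs_zero[OF g]] .
  qed
  have "(\<lambda>k. E rho_p k - E rho_m k + rho_p * (z k)\<^sup>2 * g rho_p k - rho_m * (y k)\<^sup>2 * g rho_m k)
      \<longlonglongrightarrow> 0 - 0 + 0 - 0"
    using rho by (intro tendsto_add tendsto_diff E_tendsto null bound) auto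
  moreover have "E rho_p k - E rho_m k + rho_p * (z k)\<^sup>2 * g rho_p k - rho_m * (y k)\<^sup>2 * g rho_m k
     = (p * y k - q * z k) * (p * y k + q * z k)" for k
  proof -
    have "(p * y k - q * z k) * (p * y k + q * z k) = rho_m * (y k)\<^sup>2 - rho_p * (z k)\<^sup>2"
      unfolding pq(3,4)[symmetric] by algebra
    then show ?thesis using P[of rho_m k] P[of rho_p k]
      by (simp add: g_def y_def z_def algebra_simps)
  qed
  ultimately have prod: "(\<lambda>k. (p * y k - q * z k) * (p * y k + q * z k)) \<longlonglongrightarrow> 0" by simp
  \<comment> \<open>A lower bound for the conjugate factor: the drops are nonnegative with the fixed
    sum \<open>D > 0\<close>.\<close>
  define l where "l = min p q * D"
  have l: "l > 0" using pq D by (simp add: l_def)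
  have low: "l \<le> p * y k + q * z k" for k
  proof -
    have "min p q * y k \<le> p * y k" "min p q * z k \<le> q * z k"
      using yz[of k] by (auto intro!: mult_right_mono)
    then show ?thesis unfolding l_def yz(1)[of k, symmetric] by (simp add: distrib_left)
  qed
  have "(\<lambda>k. p * y k - q * z k) \<longlonglongrightarrow> 0"
  proof (rule Lim_null_comparison)
    show "(\<lambda>k. \<bar>(p * y k - q * z k) * (p * y k + q * z k)\<bar> / l) \<longlonglongrightarrow> 0"
      using tendsto_divide[OF tendsto_rabs_zero[OF prod] tendsto_const[of l]] l by simp
    have "\<bar>p * y k - q * z k\<bar> * l \<le> \<bar>p * y k - q * z k\<bar> * \<bar>p * y k + q * z k\<bar>" for k
      using low[of k] l by (intro mult_left_mono) auto
    then show "\<forall>\<^sub>F k in sequentially. norm (p * y k - q * z k) \<le>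
        \<bar>(p * y k - q * z k) * (p * y k + q * z k)\<bar> / l"
      using l by (intro always_eventually allI) (simp add: pos_le_divide_eq abs_mult)
  qed
  then have "(\<lambda>k. (p * u_m + q * u_p) / (p + q) - (p * y k - q * z k) / (p + q)) \<longlonglongrightarrow>
       (p * u_m + q * u_p) / (p + q) - 0 / (p + q)"
    using pq by (intro tendsto_intros) auto
  \<comment> \<open>Averaging \<open>us k = u_m - y k\<close> and \<open>us k = u_p + z k\<close>
    with weights \<open>p\<close> and \<open>q\<close> leaves exactly the null sequence as
    error.\<close>
  moreover have "us = (\<lambda>k. (p * u_m + q * u_p) / (p + q) - (p * y k - q * z k) / (p + q))"
  proof
    fix k
    have "us k = u_m - y k" "us k = u_p + z k" using us[of k] by (auto simp: y_def z_def)
    then have "us k * (p + q) = p * (u_m - y k) + q * (u_p + z k)" by (metis distrib_left mult.commute)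
    then have "us k = (p * (u_m - y k) + q * (u_p + z k)) / (p + q)" using pq by (simp add: eq_divide_eq)
    then show "us k = (p * u_m + q * u_p) / (p + q) - (p * y k - q * z k) / (p + q)"
      by (simp add: algebra_simps flip: diff_divide_distrib)
  qed
  ultimately show ?thesis by (simp add: sigma_delta_def flip: p_def q_def)
qed

text \<open>Both inequalities come from \<open>u_p < us k < u_m\<close>. They ensure that the strip
  between the shocks is nonempty for every index.\<close>

lemma shock_speed_order:
  "shock_speed rho_m u_m (rs k) (us k) < us k" "us k < shock_speed (rs k) (us k) rho_p u_p"
proof -
  have "rho_m * us k < rho_m * u_m" "rho_p * u_p < rho_p * us k" using us[of k] rho by auto
  then show "shock_speed rho_m u_m (rs k) (us k) < us k" "us k < shock_speed (rs k) (us k) rho_p u_p"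
    unfolding shock_speed_def using rs[of k] by (simp_all add: divide_less_eq less_divide_eq algebra_simps)
qed

text \<open>Each speed is \<open>us k\<close> plus a correction with bounded numerator and
  denominator \<open>rs k - b\<close>, which tends to infinity.\<close>

lemma shock_speed_tendsto:
  "(\<lambda>k. shock_speed rho_m u_m (rs k) (us k)) \<longlonglongrightarrow> sigma_delta rho_m u_m rho_p u_p"
  "(\<lambda>k. shock_speed (rs k) (us k) rho_p u_p) \<longlonglongrightarrow> sigma_delta rho_m u_m rho_p u_p"
proof -
  let ?\<sigma> = "sigma_delta rho_m u_m rho_p u_p"
  have lim: "(\<lambda>k. us k + b * (us k - v) / (rs k - b)) \<longlonglongrightarrow> ?\<sigma>" for b v
  proof -
    have "filterlim (\<lambda>k. - b + rs k) at_top sequentially"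
      by (rule filterlim_tendsto_add_at_top[OF tendsto_const intermediate_density_tendsto])
    then have "(\<lambda>k. b * (us k - v) / (- b + rs k)) \<longlonglongrightarrow> 0"
      by (intro tendsto_divide_0[where c = "b * (?\<sigma> - v)"] filterlim_at_top_imp_at_infinity
          tendsto_intros intermediate_velocity_tendsto)
    from tendsto_add[OF intermediate_velocity_tendsto this] show ?thesis by simp
  qed
  have "shock_speed rho_m u_m (rs k) (us k) = us k + rho_m * (us k - u_m) / (rs k - rho_m)"
    "shock_speed (rs k) (us k) rho_p u_p = us k + rho_p * (us k - u_p) / (rs k - rho_p)" for k
    unfolding shock_speed_def using rs[of k] by (auto simp: field_simps)
  then show "(\<lambda>k. shock_speed rho_m u_m (rs k) (us k)) \<longlonglongrightarrow> ?\<sigma>"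
    "(\<lambda>k. shock_speed (rs k) (us k) rho_p u_p) \<longlonglongrightarrow> ?\<sigma>"
    using lim by simp_all
qed

text \<open>A product of an unbounded density and a vanishing width. Adding the two Rankine-Hugoniot
  mass relations cancels \<open>rs k * us k\<close> and expresses it through the speeds and the
  outer states alone.\<close>

lemma intermediate_mass_tendsto:
  "(\<lambda>k. rs k * (shock_speed (rs k) (us k) rho_p u_p - shock_speed rho_m u_m (rs k) (us k))) \<longlonglongrightarrow>
    sigma_delta rho_m u_m rho_p u_p * (rho_p - rho_m) - (rho_p * u_p - rho_m * u_m)"
proof -
  have "rs k * (shock_speed (rs k) (us k) rho_p u_p - shock_speed rho_m u_m (rs k) (us k)) =
      shock_speed (rs k) (us k) rho_p u_p * rho_p - shock_speed rho_m u_m (rs k) (us k) * rho_m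
      - (rho_p * u_p - rho_m * u_m)" for k
  proof -
    have "shock_speed rho_m u_m (rs k) (us k) * (rs k - rho_m) = rs k * us k - rho_m * u_m"
      "shock_speed (rs k) (us k) rho_p u_p * (rho_p - rs k) = rho_p * u_p - rs k * us k"
      unfolding shock_speed_def using rs[of k] by auto
    then show ?thesis by argo
  qed
  moreover have "(\<lambda>k. shock_speed (rs k) (us k) rho_p u_p * rho_p - shock_speed rho_m u_m (rs k) (us k) * rho_m
      - (rho_p * u_p - rho_m * u_m)) \<longlonglongrightarrow>
      sigma_delta rho_m u_m rho_p u_p * rho_p - sigma_delta rho_m u_m rho_p u_p * rho_m
      - (rho_p * u_p - rho_m * u_m)"
    by (intro tendsto_intros shock_speed_tendsto)
  ultimately show ?thesis by (simp add: right_diff_distrib)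
qed

end

text \<open>The definition of \<sigma> says
  \<open>p * (\<sigma> - u_m) + q * (\<sigma> - u_p) = 0\<close>. Multiplying by the conjugate gives
  a difference of squares, which expands to the claim. It identifies the momentum weight as \<sigma>
  times the mass weight.\<close>

lemma sigma_delta_quadratic:
  assumes "rho_m > 0" "rho_p > 0" and \<sigma>: "\<sigma> = sigma_delta rho_m u_m rho_p u_p"
  shows "\<sigma> * (\<sigma> * (rho_p - rho_m) - (rho_p * u_p - rho_m * u_m)) =
    \<sigma> * (rho_p * u_p - rho_m * u_m) - (rho_p * u_p\<^sup>2 - rho_m * u_m\<^sup>2)"
proof -
  define p q where "p = sqrt rho_m" and "q = sqrt rho_p"
  have pq: "p > 0" "q > 0" "rho_m = p\<^sup>2" "rho_p = q\<^sup>2" using assms by (auto simp: p_def q_def)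
  have "\<sigma> * (p + q) = p * u_m + q * u_p"
    using pq(1,2) unfolding \<sigma> sigma_delta_def p_def[symmetric] q_def[symmetric] by simp
  then have "p * (\<sigma> - u_m) + q * (\<sigma> - u_p) = 0" by (simp add: algebra_simps)
  then have "q\<^sup>2 * (\<sigma> - u_p)\<^sup>2 - p\<^sup>2 * (\<sigma> - u_m)\<^sup>2 = 0" by algebra
  then show ?thesis unfolding pq(3,4) by algebra
qed

section \<open>Convergence of the pairings to a step function plus a delta measure\<close>

lemma integrable_indicator_Icc [simp]:
  fixes a b :: real
  shows "integrable lborel (indicator {a..b} :: real \<Rightarrow> real)"
  by (intro integrable_real_indicator) (auto simp: emeasure_lborel_Icc_eq)

lemma integrable_bounded_Icc:
  fixes f :: "real \<Rightarrow> real"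
  assumes "f \<in> borel_measurable lborel"
    and "\<And>x. \<bar>f x\<bar> \<le> C * indicator {a..b} x"
  shows "integrable lborel f"
proof (rule Bochner_Integration.integrable_bound)
  show "integrable lborel (\<lambda>x. C * indicator {a..b} x :: real)" by simp
  show "AE x in lborel. norm (f x) \<le> norm (C * indicator {a..b} x)"
    using assms(2) by (auto intro!: AE_I2 order_trans[OF assms(2)])
qed (fact assms)

text \<open>The substitution \<open>x = a k + (b k - a k) * y\<close> turns the integral into the
  interval length times an average of \<open>h\<close> over the unit interval, and the averages tend
  to \<open>h c\<close> by dominated convergence. A strip of height \<open>r k\<close> and mass
  tending to \<open>m\<close> thus acts like \<open>m\<close> times a point mass at
  \<open>c\<close>; the second claim later supplies a dominating function in time.\<close>

lemma scaled_average_tendsto: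
  fixes h :: "real \<Rightarrow> real"
  assumes h: "continuous_on UNIV h" and C: "\<And>x. \<bar>h x\<bar> \<le> C"
    and ab: "\<And>k. a k < b k" and a: "a \<longlonglongrightarrow> c" and b: "b \<longlonglongrightarrow> c"
    and r: "(\<lambda>k. r k * (b k - a k)) \<longlonglongrightarrow> m"
  shows "(\<lambda>k. r k * (LINT x|lborel. indicator {a k..<b k} x * h x)) \<longlonglongrightarrow> m * h c"
    and "\<bar>r k * (LINT x|lborel. indicator {a k..<b k} x * h x)\<bar> \<le> \<bar>r k * (b k - a k)\<bar> * C"
proof -
  have hb[measurable]: "h \<in> borel_measurable borel"
    using h by (simp add: borel_measurable_continuous_onI)
  define avg where "avg k = (LINT y|lborel. indicator {0..<1} y * h (a k + (b k - a k) * y))" for k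
  have ind: "indicator {a k..<b k} (a k + (b k - a k) * y) = (indicator {0..<1} y :: real)" for k y
  proof -
    have p: "0 < b k - a k" using ab[of k] by simp
    have 1: "0 \<le> (b k - a k) * y \<longleftrightarrow> 0 \<le> y" using p by (simp add: zero_le_mult_iff)
    have 2: "(b k - a k) * y < (b k - a k) * 1 \<longleftrightarrow> y < 1" using p by (simp only: mult_less_cancel_left_pos)
    show ?thesis using 1 2 by (auto simp: indicator_def)
  qed
  have avg: "(LINT x|lborel. indicator {a k..<b k} x * h x) = (b k - a k) * avg k" for k
    unfolding avg_def
    by (subst lborel_integral_real_affine[where c = "b k - a k" and t = "a k"])
      (use ab[of k] in \<open>simp_all add: ind\<close>)
  have C0: "0 \<le> C" using C[of 0] by linarith
  have bnd: "\<bar>indicator {0..<1} y * h z\<bar> \<le> C * indicator {0..1} y" for y z :: real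
    using C[of z] C0 by (auto simp: indicator_def)
  have "avg \<longlonglongrightarrow> (LINT y|lborel. indicator {0..<1::real} y * h c)"
    unfolding avg_def
  proof (rule integral_dominated_convergence[where w = "\<lambda>y::real. C * indicator {0..1} y"])
    show "AE y in lborel. (\<lambda>k. indicator {0..<1} y * h (a k + (b k - a k) * y))
        \<longlonglongrightarrow> indicator {0..<1} y * h c"
    proof (rule AE_I2)
      fix y :: real
      have "(\<lambda>k. a k + (b k - a k) * y) \<longlonglongrightarrow> c + (c - c) * y"
        by (intro tendsto_intros a b)
      then have "(\<lambda>k. h (a k + (b k - a k) * y)) \<longlonglongrightarrow> h c"
        using h by (auto intro!: isCont_tendsto_compose[of _ h] simp: continuous_on_eq_continuous_at)
      then show "(\<lambda>k. indicator {0..<1} y * h (a k + (b k - a k) * y))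
        \<longlonglongrightarrow> indicator {0..<1} y * h c" by (intro tendsto_intros)
    qed
  qed (use bnd in \<open>auto\<close>)
  also have "(LINT y|lborel. indicator {0..<1::real} y * h c) = h c"
    by simp
  finally have lim: "avg \<longlonglongrightarrow> h c" .
  have eq: "r k * (LINT x|lborel. indicator {a k..<b k} x * h x) = (r k * (b k - a k)) * avg k" for k
    by (simp add: avg)
  show "(\<lambda>k. r k * (LINT x|lborel. indicator {a k..<b k} x * h x)) \<longlonglongrightarrow> m * h c"
    unfolding eq by (intro tendsto_mult r lim)
  have "\<bar>avg k\<bar> \<le> (LINT y|lborel. C * indicator {0..1::real} y)"
  proof -
    have "integrable lborel (\<lambda>y. indicator {0..<1} y * h (a k + (b k - a k) * y))"
      by (rule integrable_bounded_Icc[OF _ bnd]) measurable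
    then have "norm (avg k) \<le> (LINT y|lborel. C * indicator {0..1::real} y)"
      unfolding avg_def
      by (intro order_trans[OF integral_norm_bound] integral_mono) (use bnd in auto)
    then show ?thesis by simp
  qed
  then have "\<bar>avg k\<bar> \<le> C" by simp
  then show "\<bar>r k * (LINT x|lborel. indicator {a k..<b k} x * h x)\<bar> \<le> \<bar>r k * (b k - a k)\<bar> * C"
    unfolding eq abs_mult by (intro mult_left_mono) auto
qed

text \<open>Extracts what dominated convergence uses: continuity, a uniform bound and a bounded
  support, all restricted to \<open>t \<ge> 0\<close> because \<phi> is arbitrary below.\<close>

lemma test_functionE:
  assumes "test_function_on closed_half_plane \<phi>"
  obtains C R where "continuous_on closed_half_plane \<phi>" "R > 0"
    "\<And>x t. t \<ge> 0 \<Longrightarrow> \<bar>\<phi> (x, t)\<bar> \<le> C"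
    "\<And>x t. t \<ge> 0 \<Longrightarrow> \<phi> (x, t) \<noteq> 0 \<Longrightarrow> \<bar>x\<bar> \<le> R \<and> t \<le> R"
proof -
  obtain U g K where U: "open U" "closed_half_plane \<subseteq> U" "\<And>k. Ck_on k U g"
      "\<And>p. p \<in> closed_half_plane \<Longrightarrow> \<phi> p = g p"
    and K: "compact K" "K \<subseteq> closed_half_plane" "\<And>p. p \<in> closed_half_plane - K \<Longrightarrow> \<phi> p = 0"
    using assms unfolding test_function_on_def by metis
  have "continuous_on closed_half_plane g"
    using U(3)[of 0] U(2) continuous_on_subset by auto
  then have cont: "continuous_on closed_half_plane \<phi>"
    using U(4) by (simp cong: continuous_on_cong)
  have "compact (\<phi> ` K)"
    using compact_continuous_image[OF continuous_on_subset[OF cont K(2)] K(1)] .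
  then obtain C where C: "\<And>p. p \<in> K \<Longrightarrow> \<bar>\<phi> p\<bar> \<le> C"
    using compact_imp_bounded[of "\<phi> ` K"] unfolding bounded_iff by auto
  obtain R where R: "\<And>p. p \<in> K \<Longrightarrow> norm p \<le> R" "R > 0"
    using compact_imp_bounded[OF K(1)] unfolding bounded_pos by auto
  show ?thesis
  proof (rule that[OF cont R(2)])
    fix x t :: real assume t: "t \<ge> 0"
    show "\<bar>\<phi> (x, t)\<bar> \<le> max C 0" using K(3)[of "(x,t)"] C[of "(x,t)"] t by (cases "(x,t) \<in> K") auto
    show "\<bar>x\<bar> \<le> R \<and> t \<le> R" if "\<phi> (x, t) \<noteq> 0"
      using K(3)[of "(x,t)"] R(1)[of "(x,t)"] t that norm_fst_le[of x t] norm_snd_le[of t x]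
      by (cases "(x,t) \<in> K") fastforce+
  qed
qed

text \<open>Stated for a general quantity with value \<open>r k\<close> between the shocks, so that
  it serves both density and momentum. At time \<open>t\<close> the strip has width
  \<open>t * (s2 k - s1 k)\<close>, hence carries mass tending to \<open>m * t\<close>; the outer
  states converge to the step function.\<close>

lemma fun_pairing_two_jumps_tendsto:
  fixes f :: "nat \<Rightarrow> real \<times> real \<Rightarrow> real"
  assumes \<phi>: "test_function_on closed_half_plane \<phi>"
    and s: "\<And>k. s1 k < s2 k" "s1 \<longlonglongrightarrow> \<sigma>" "s2 \<longlonglongrightarrow> \<sigma>"
    and r: "(\<lambda>k. r k * (s2 k - s1 k)) \<longlonglongrightarrow> m"
    and f: "\<And>k x t. t > 0 \<Longrightarrow> x / t < s1 k \<Longrightarrow> f k (x, t) = q_m"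
      "\<And>k x t. t > 0 \<Longrightarrow> s1 k < x / t \<Longrightarrow> x / t < s2 k \<Longrightarrow> f k (x, t) = r k"
      "\<And>k x t. t > 0 \<Longrightarrow> s2 k < x / t \<Longrightarrow> f k (x, t) = q_p"
    and w: "\<And>t. w t = t / sqrt (1 + \<sigma>\<^sup>2) * m"
  shows "(\<lambda>k. fun_pairing (f k) \<phi>) \<longlonglongrightarrow> step_delta_pairing \<sigma> q_m q_p w \<phi>"
proof -
  obtain C R where cont: "continuous_on closed_half_plane \<phi>" and R: "R > 0"
    and C: "\<And>x t. t \<ge> 0 \<Longrightarrow> \<bar>\<phi> (x, t)\<bar> \<le> C"
    and supp: "\<And>x t. t \<ge> 0 \<Longrightarrow> \<phi> (x, t) \<noteq> 0 \<Longrightarrow> \<bar>x\<bar> \<le> R \<and> t \<le> R"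
    by (rule test_functionE[OF \<phi>]) (rule that)
  have C0: "0 \<le> C" using C[of 0 0] by simp
  \<comment> \<open>Extension by zero below \<open>t = 0\<close> makes the test function Borel
    measurable on the whole plane.\<close>
  define \<psi> where "\<psi> p = indicator closed_half_plane p * \<phi> p" for p
  have \<psi>\<phi>: "\<psi> (x, t) = \<phi> (x, t)" if "t \<ge> 0" for x t using that by (simp add: \<psi>_def)
  have [measurable]: "\<psi> \<in> borel_measurable borel"
    using borel_measurable_continuous_on_indicator[OF _ cont] unfolding \<psi>_def
    by (simp add: closed_Times borel_closed)
  have [measurable]: "\<psi> \<in> borel_measurable (borel \<Otimes>\<^sub>M borel)"
    by (simp add: borel_prod)
  have \<psi>C: "\<bar>\<psi> p\<bar> \<le> C" for p using C C0 by (cases p) (auto simp: \<psi>_def indicator_def)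
  have \<psi>supp: "\<psi> (x, t) = 0" if "\<not> (\<bar>x\<bar> \<le> R \<and> 0 \<le> t \<and> t \<le> R)" for x t
    using supp[of t x] that by (auto simp: \<psi>_def indicator_def)
  have \<psi>out: "\<psi> (x, t) = 0" if "x < -R \<or> R < x" for x t
    by (rule \<psi>supp) (use that in linarith)
  have \<psi>cont: "continuous_on UNIV (\<lambda>x. \<psi> (x, t))" if "t > 0" for t
  proof -
    have "continuous_on UNIV (\<lambda>x. \<phi> (x, t))"
      using that by (intro continuous_on_compose2[OF cont] continuous_intros) auto
    then show ?thesis using that by (simp add: \<psi>\<phi>)
  qed
  define Q where "Q = max \<bar>q_m\<bar> \<bar>q_p\<bar>"
  have Q0: "0 \<le> Q" by (simp add: Q_def)
  \<comment> \<open>The solution with its middle state replaced by 0: bounded by \<open>Q\<close>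
    uniformly in the shock positions, and equal to the step function when
    \<open>a = b\<close>.\<close>
  define outer where "outer a b x = (if x < a then q_m else if x < b then 0 else q_p)" for a b x :: real
  have outerQ: "\<bar>outer a b x\<bar> \<le> Q" for a b x by (auto simp: outer_def Q_def)
  have [measurable]: "outer a b \<in> borel_measurable borel" for a b
    unfolding outer_def by measurable
  define I where "I a b t = (LINT x|lborel. outer (a * t) (b * t) x * \<psi> (x, t))" for a b t
  define J where "J k t = r k * (LINT x|lborel. indicator {s1 k * t..<s2 k * t} x * \<psi> (x, t))" for k t
  have [measurable]: "I a b \<in> borel_measurable borel" for a b
    unfolding I_def outer_def by measurable
  have [measurable]: "J k \<in> borel_measurable borel" for k
    unfolding J_def indicator_def of_bool_def atLeastLessThan_iff by measurable
  have bnd: "\<bar>outer a b x * \<psi> (x, t)\<bar> \<le> Q * C * indicator {-R..R} x" for a b x t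
  proof (cases "\<bar>x\<bar> \<le> R")
    case True
    then show ?thesis using mult_mono[OF outerQ[of a b x] \<psi>C[of "(x, t)"] Q0]
      by (auto simp: abs_mult indicator_def)
  next
    case False
    then show ?thesis using \<psi>supp[of x t] Q0 C0 by auto
  qed
  have int_outer: "integrable lborel (\<lambda>x. outer a b x * \<psi> (x, t))" for a b t
    by (rule integrable_bounded_Icc[OF _ bnd]) measurable
  have int_mid: "integrable lborel (\<lambda>x. indicator {a..<b} x * \<psi> (x, t))" for a b t
    by (rule integrable_bounded_Icc[of _ C "-R" R]) 
      (use \<psi>C \<psi>out C0 in \<open>auto simp: indicator_def not_le\<close>)
  have Ibnd: "\<bar>I a b t\<bar> \<le> 2 * R * Q * C * indicator {0..R} t" for a b t
  proof (cases "t \<in> {0..R}")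
    case True
    have "norm (I a b t) \<le> (LINT x|lborel. Q * C * indicator {-R..R} x)"
      unfolding I_def
      by (intro order_trans[OF integral_norm_bound] integral_mono)
        (use bnd int_outer in auto)
    then show ?thesis using True R by (simp add: mult_ac)
  next
    case False
    then have "\<psi> (x, t) = 0" for x using \<psi>supp by auto
    then show ?thesis using False by (simp add: I_def)
  qed
  have split: "(LINT x|lborel. f k (x, t) * \<phi> (x, t)) = I (s1 k) (s2 k) t + J k t" if t: "t > 0" for k t
  proof -
    let ?g = "\<lambda>x. outer (s1 k * t) (s2 k * t) x * \<psi> (x, t) +
        r k * (indicator {s1 k * t..<s2 k * t} x * \<psi> (x, t))"
    have lt: "s1 k * t < s2 k * t" using s(1)[of k] t by simp
    \<comment> \<open>The values on the two shock lines are unspecified, so equality is claimed only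
      off two points of each time slice.\<close>
    have eq: "f k (x, t) * \<phi> (x, t) = ?g x" if ne: "x \<notin> {s1 k * t, s2 k * t}" for x
    proof -
      consider "x < s1 k * t" | "s1 k * t < x" "x < s2 k * t" | "s2 k * t < x"
        using ne by fastforce
      then show ?thesis
      proof cases
        case 1 then show ?thesis using f(1)[of t x k] t lt
          by (simp add: outer_def \<psi>\<phi> divide_less_eq)
      next
        case 2 then show ?thesis using f(2)[of t k x] t lt
          by (simp add: outer_def \<psi>\<phi> divide_less_eq less_divide_eq)
      next
        case 3
        then have "\<not> x < s1 k * t" "\<not> x < s2 k * t" using lt by linarith+
        with 3 show ?thesis using f(3)[of t k x] t
          by (simp add: outer_def \<psi>\<phi> divide_less_eq less_divide_eq)
      qed
    qed
    \<comment> \<open>Measurability of \<open>f k\<close> is not assumed; each slice is a measurable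
      function altered at two points.\<close>
    have "(\<lambda>x. f k (x, t) * \<phi> (x, t)) =
        (\<lambda>x. if x = s1 k * t then f k (s1 k * t, t) * \<phi> (s1 k * t, t)
          else if x = s2 k * t then f k (s2 k * t, t) * \<phi> (s2 k * t, t) else ?g x)"
      using eq by auto
    also have "\<dots> \<in> borel_measurable borel" by measurable
    finally have meas: "(\<lambda>x. f k (x, t) * \<phi> (x, t)) \<in> borel_measurable borel" .
    have "(LINT x|lborel. f k (x, t) * \<phi> (x, t)) = (LINT x|lborel. ?g x)"
    proof (rule integral_cong_AE)
      show "AE x in lborel. f k (x, t) * \<phi> (x, t) = ?g x"
        using AE_lborel_singleton[of "s1 k * t"] AE_lborel_singleton[of "s2 k * t"]
        by eventually_elim (rule eq, simp)
    qed (use meas in auto)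
    also have "\<dots> = I (s1 k) (s2 k) t + J k t"
      unfolding I_def J_def by (subst Bochner_Integration.integral_add) (use int_outer int_mid in auto)
    finally show ?thesis .
  qed
  \<comment> \<open>Convergent strip masses are bounded, which makes the bound for \<open>J\<close>
    uniform in \<open>k\<close>.\<close>
  obtain M where M: "\<And>k. \<bar>r k * (s2 k - s1 k)\<bar> \<le> M"
    using convergent_imp_Bseq[OF convergentI[OF r]] unfolding Bseq_def by auto
  have M0: "0 \<le> M" using M[of 0] by linarith
  have J: "(\<lambda>k. J k t) \<longlonglongrightarrow> (m * t) * \<psi> (\<sigma> * t, t)"
      "\<bar>J k t\<bar> \<le> M * R * C * indicator {0..R} t" if t: "t > 0" for t k
  proof -
    have r': "(\<lambda>k. r k * (s2 k * t - s1 k * t)) \<longlonglongrightarrow> m * t"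
      using tendsto_mult_right[OF r, of t] by (simp add: algebra_simps)
    note avg = scaled_average_tendsto[where h = "\<lambda>x. \<psi> (x, t)" and C = C and c = "\<sigma> * t",
        OF \<psi>cont[OF t] \<psi>C _ _ _ r'] 
    show "(\<lambda>k. J k t) \<longlonglongrightarrow> (m * t) * \<psi> (\<sigma> * t, t)"
      unfolding J_def by (rule avg) (use s t in \<open>auto intro!: tendsto_mult_right\<close>)
    have 1: "\<bar>J k t\<bar> \<le> \<bar>r k * (s2 k * t - s1 k * t)\<bar> * C"
      unfolding J_def by (rule avg) (use s t in \<open>auto intro!: tendsto_mult_right\<close>)
    show "\<bar>J k t\<bar> \<le> M * R * C * indicator {0..R} t"
    proof (cases "t \<le> R")
      case True
      have "\<bar>r k * (s2 k * t - s1 k * t)\<bar> = \<bar>r k * (s2 k - s1 k)\<bar> * t"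
        using t by (simp add: abs_mult flip: left_diff_distrib)
      also have "\<dots> \<le> M * R" using M[of k] t True M0 by (intro mult_mono) auto
      finally show ?thesis using 1 C0 True t mult_right_mono by fastforce
    next
      case False
      then have "\<psi> (x, t) = 0" for x using \<psi>supp by auto
      then show ?thesis using False by (simp add: J_def)
    qed
  qed
  \<comment> \<open>For \<open>x \<noteq> \<sigma> * t\<close> both shocks eventually lie on the
    same side of \<open>x\<close>, so \<open>outer\<close> is eventually constant in
    \<open>k\<close>.\<close>
  have Ilim: "(\<lambda>k. I (s1 k) (s2 k) t) \<longlonglongrightarrow> I \<sigma> \<sigma> t" for t
    unfolding I_def
  proof (rule integral_dominated_convergence[where w = "\<lambda>x. Q * C * indicator {-R..R} x"])
    show "AE x in lborel. (\<lambda>k. outer (s1 k * t) (s2 k * t) x * \<psi> (x, t))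
        \<longlonglongrightarrow> outer (\<sigma> * t) (\<sigma> * t) x * \<psi> (x, t)"
      using AE_lborel_singleton[of "\<sigma> * t"]
    proof eventually_elim
      case (elim x)
      have l: "(\<lambda>k. s1 k * t) \<longlonglongrightarrow> \<sigma> * t" "(\<lambda>k. s2 k * t) \<longlonglongrightarrow> \<sigma> * t"
        using s by (auto intro: tendsto_mult_right)
      consider "x < \<sigma> * t" | "\<sigma> * t < x" using elim by linarith
      then have "\<forall>\<^sub>F k in sequentially. outer (s1 k * t) (s2 k * t) x = outer (\<sigma> * t) (\<sigma> * t) x"
      proof cases
        case 1
        show ?thesis using order_tendstoD(1)[OF l(1) 1]
          by eventually_elim (use 1 in \<open>simp add: outer_def\<close>)
      next
        case 2
        show ?thesis using order_tendstoD(2)[OF l(1) 2] order_tendstoD(2)[OF l(2) 2]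
          by eventually_elim (use 2 in \<open>simp add: outer_def\<close>)
      qed
      then show ?case by (intro tendsto_mult_right tendsto_eventually)
    qed
  qed (use bnd in auto)
  let ?P = "indicator {0<..} :: real \<Rightarrow> real"
  have "(\<lambda>k. LINT t|lborel. ?P t * (I (s1 k) (s2 k) t + J k t)) \<longlonglongrightarrow>
      (LINT t|lborel. ?P t * (I \<sigma> \<sigma> t + (m * t) * \<psi> (\<sigma> * t, t)))"
  proof (rule integral_dominated_convergence[where w = "\<lambda>t. (2 * R * Q * C + M * R * C) * indicator {0..R} t"])
    show "AE t in lborel. (\<lambda>k. ?P t * (I (s1 k) (s2 k) t + J k t))
        \<longlonglongrightarrow> ?P t * (I \<sigma> \<sigma> t + (m * t) * \<psi> (\<sigma> * t, t))"
      using Ilim J(1) by (intro AE_I2) (auto simp: indicator_def intro!: tendsto_add)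
    show "AE t in lborel. norm (?P t * (I (s1 k) (s2 k) t + J k t))
        \<le> (2 * R * Q * C + M * R * C) * indicator {0..R} t" for k
    proof (rule AE_I2)
      fix t
      show "norm (?P t * (I (s1 k) (s2 k) t + J k t))
        \<le> (2 * R * Q * C + M * R * C) * indicator {0..R} t"
        using Ibnd[of "s1 k" "s2 k" t] J(2)[of t k] R C0 M0
        by (cases "t > 0") (auto simp: indicator_def Q_def split: if_splits)
    qed
  qed auto
  also have "(LINT t|lborel. ?P t * (I \<sigma> \<sigma> t + (m * t) * \<psi> (\<sigma> * t, t))) =
      (LINT t|lborel. ?P t * I \<sigma> \<sigma> t) + (LINT t|lborel. ?P t * ((m * t) * \<psi> (\<sigma> * t, t)))"
  proof -
    have "integrable lborel (\<lambda>t. ?P t * I \<sigma> \<sigma> t)"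
    proof (rule integrable_bounded_Icc)
      fix t
      have "\<bar>?P t * I \<sigma> \<sigma> t\<bar> \<le> \<bar>I \<sigma> \<sigma> t\<bar>" by (simp add: indicator_def)
      also note Ibnd
      finally show "\<bar>?P t * I \<sigma> \<sigma> t\<bar> \<le> 2 * R * Q * C * indicator {0..R} t" .
    qed measurable
    moreover have "integrable lborel (\<lambda>t. ?P t * ((m * t) * \<psi> (\<sigma> * t, t)))"
    proof (rule integrable_bounded_Icc[of _ "\<bar>m\<bar> * R * C" 0 R])
      fix t
      show "\<bar>?P t * ((m * t) * \<psi> (\<sigma> * t, t))\<bar> \<le> \<bar>m\<bar> * R * C * indicator {0..R} t"
        using \<psi>supp[of "\<sigma> * t" t] \<psi>C[of "(\<sigma> * t, t)"] R
        by (auto simp: indicator_def abs_mult intro!: mult_mono)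
    qed measurable
    ultimately show ?thesis by (simp add: distrib_left)
  qed
  also have "(LINT t|lborel. ?P t * I \<sigma> \<sigma> t) = fun_pairing (\<lambda>(x, t). step_fun q_m q_p (x - \<sigma> * t)) \<phi>"
    unfolding fun_pairing_def set_lebesgue_integral_def I_def outer_def step_fun_def Heaviside_def
    by (intro Bochner_Integration.integral_cong refl)
      (auto simp: indicator_def \<psi>\<phi> intro!: Bochner_Integration.integral_cong)
  also have "(LINT t|lborel. ?P t * ((m * t) * \<psi> (\<sigma> * t, t))) =
      delta_pairing {0..} (\<lambda>t. \<sigma> * t) (\<lambda>t. t) w \<phi>"
  proof -
    \<comment> \<open>The arc length element of \<open>S\<close> cancels the normalization in
      \<open>w\<close>; at \<open>t = 0\<close> the weight vanishes, so the open and the closed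
      half-line give the same integrand.\<close>
    have "sqrt (1 + \<sigma>\<^sup>2) > 0" by (simp add: add_pos_nonneg)
    then show ?thesis
      unfolding delta_pairing_def set_lebesgue_integral_def
      by (intro Bochner_Integration.integral_cong refl)
        (auto simp: indicator_def \<psi>\<phi> w add.commute not_less)
  qed
  finally show ?thesis
    unfolding step_delta_pairing_def fun_pairing_def set_lebesgue_integral_def
    by (rule Lim_transform_eventually)
      (auto intro!: always_eventually Bochner_Integration.integral_cong simp: indicator_def split)
qed

section \<open>Integration by parts and the transport equations\<close>

text \<open>The distributional derivative of a step function is its jump times the point mass at 0.
  The step is a constant plus the jump times the indicator of the right half-line, and the
  fundamental theorem is applied to each part.\<close>

lemma integral_deriv_compact_support:
  fixes F f :: "real \<Rightarrow> real"
  assumes F: "\<And>x. (F has_real_derivative f x) (at x)" and f: "continuous_on UNIV f"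
    and supp: "\<And>x. \<bar>x\<bar> > R \<Longrightarrow> F x = 0" "\<And>x. \<bar>x\<bar> > R \<Longrightarrow> f x = 0"
  shows "(LINT x|lborel. step_fun q_m q_p x * f x) = - (q_p - q_m) * F 0"
    and "(LINT x|lborel. f x) = 0" and "integrable lborel f"
proof -
  \<comment> \<open>Positive and strictly beyond \<open>R\<close>, so that \<open>F\<close> vanishes
    at both ends of the interval.\<close>
  define a where "a = \<bar>R\<bar> + 1"
  have a: "a > 0" "a > R" by (auto simp: a_def)
  have cont: "isCont f x" for x using f by (simp add: continuous_on_eq_continuous_at)
  have 1: "has_bochner_integral lborel (\<lambda>x. f x * indicator {-a..a} x) (F a - F (-a))"
    by (rule has_bochner_integral_FTC_Icc_real) (use a F cont in auto)
  have 2: "has_bochner_integral lborel (\<lambda>x. f x * indicator {0..a} x) (F a - F 0)"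
    by (rule has_bochner_integral_FTC_Icc_real) (use a F cont in auto)
  have F0: "F a = 0" "F (-a) = 0" using supp a by auto
  have "f x * indicator {-a..a} x = f x" for x
    using supp(2)[of x] a by (cases "\<bar>x\<bar> > R") (auto simp: indicator_def)
  with 1 F0 have 3: "has_bochner_integral lborel f 0" by simp
  then show "(LINT x|lborel. f x) = 0" "integrable lborel f"
    by (auto simp: has_bochner_integral_iff)
  have "step_fun q_m q_p x * f x = q_m * f x + (q_p - q_m) * (f x * indicator {0..a} x)" for x
    using supp(2)[of x] a by (cases "\<bar>x\<bar> > R") (auto simp: indicator_def step_fun_def Heaviside_def algebra_simps)
  moreover have "has_bochner_integral lborel (\<lambda>x. q_m * f x + (q_p - q_m) * (f x * indicator {0..a} x))
      (q_m * 0 + (q_p - q_m) * (F a - F 0))"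
    by (intro has_bochner_integral_add has_bochner_integral_mult_right 2 3)
  ultimately show "(LINT x|lborel. step_fun q_m q_p x * f x) = - (q_p - q_m) * F 0"
    using F0 by (simp add: has_bochner_integral_iff left_diff_distrib)
qed

text \<open>The support is a compact subset of the open half-plane, so extension by zero is
  continuously differentiable on the whole plane: the half-plane and the complement of
  \<open>K\<close> are open and cover it, and the derivative is that of \<open>g\<close> on the one
  and 0 on the other. \<open>W\<close> and \<open>V\<close> are the partial derivatives in
  \<open>x\<close> and \<open>t\<close>.\<close>

lemma test_function_openE:
  assumes "test_function_on open_half_plane \<psi>"
  obtains \<eta> V W :: "real \<times> real \<Rightarrow> real" and R where
    "\<And>p. (\<eta> has_derivative (\<lambda>(a, b). W p * a + V p * b)) (at p)"
    "continuous_on UNIV V" "continuous_on UNIV W" "R > 0"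
    "\<And>x t. \<not> (\<bar>x\<bar> \<le> R \<and> 0 < t \<and> t \<le> R) \<Longrightarrow> \<eta> (x, t) = 0 \<and> V (x, t) = 0 \<and> W (x, t) = 0"
    "\<And>x t. t > 0 \<Longrightarrow> d_x \<psi> (x, t) = W (x, t)"
    "\<And>x t. t > 0 \<Longrightarrow> d_t \<psi> (x, t) = V (x, t)"
proof -
  obtain U g K where U: "open U" "open_half_plane \<subseteq> U" "\<And>k. Ck_on k U g"
      "\<And>p. p \<in> open_half_plane \<Longrightarrow> \<psi> p = g p"
    and K: "compact K" "K \<subseteq> open_half_plane" "\<And>p. p \<in> open_half_plane - K \<Longrightarrow> \<psi> p = 0"
    using assms unfolding test_function_on_def by metis
  have opn: "open open_half_plane" "open (- K)"
    using K(1) by (auto intro: open_Times compact_imp_closed)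
  define \<eta> where "\<eta> p = (if p \<in> open_half_plane then g p else 0)" for p
  define D where "D p = frechet_derivative \<eta> (at p)" for p
  have gd: "(g has_derivative frechet_derivative g (at p)) (at p)" if "p \<in> open_half_plane" for p
    using U(3)[of "Suc 0"] U(2) that by (auto simp: frechet_derivative_works)
  have 1: "(\<eta> has_derivative frechet_derivative g (at p)) (at p)" if "p \<in> open_half_plane" for p
    using that by (intro has_derivative_transform_within_open[OF gd opn(1)]) (auto simp: \<eta>_def)
  have \<eta>0: "\<eta> p = 0" if "p \<in> - K" for p
    using that K(3)[of p] U(4)[of p] by (auto simp: \<eta>_def)
  have 2: "(\<eta> has_derivative (\<lambda>v. 0)) (at p)" if "p \<in> - K" for p
    using that by (intro has_derivative_transform_within_open[OF has_derivative_const opn(2)]) (auto simp: \<eta>0)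
  have cover: "open_half_plane \<union> - K = UNIV" using K(2) by auto
  have \<eta>D: "(\<eta> has_derivative D p) (at p)" for p
    using 1[of p] 2[of p] cover unfolding D_def
    by (metis UNIV_I UnE frechet_derivative_at)
  have D1: "D p = frechet_derivative g (at p)" if "p \<in> open_half_plane" for p
    using frechet_derivative_at[OF 1[OF that]] by (simp add: D_def)
  have D2: "D p = (\<lambda>v. 0)" if "p \<in> - K" for p
    using frechet_derivative_at[OF 2[OF that]] by (simp add: D_def)
  have contD: "continuous_on UNIV (\<lambda>p. D p v)" for v
    unfolding cover[symmetric]
  proof (rule continuous_on_open_Un[OF opn])
    have "continuous_on U (\<lambda>p. frechet_derivative g (at p) v)"
      using U(3)[of "Suc 0"] by (cases v) simp
    then have "continuous_on open_half_plane (\<lambda>p. frechet_derivative g (at p) v)"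
      using U(2) continuous_on_subset by blast
    then show "continuous_on open_half_plane (\<lambda>p. D p v)" 
      by (rule continuous_on_cong[THEN iffD1, rotated -1]) (simp_all add: D1)
    show "continuous_on (- K) (\<lambda>p. D p v)"
      by (rule continuous_on_cong[THEN iffD1, OF refl _ continuous_on_const[of _ 0]]) (simp add: D2)
  qed
  define V W where "V p = D p (0, 1)" and "W p = D p (1, 0)" for p
  have D: "D p (a, b) = W p * a + V p * b" for p a b
  proof -
    interpret bounded_linear "D p" using \<eta>D by (rule has_derivative_bounded_linear)
    have "(a, b) = a *\<^sub>R (1, 0) + b *\<^sub>R (0, 1)" by simp
    then show ?thesis unfolding V_def W_def by (simp only: add scaleR) simp
  qed
  have Deq: "D p = (\<lambda>(a, b). W p * a + V p * b)" for p
    by (intro ext) (simp only: D split_paired_all prod.case)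
  obtain R where R: "\<And>p. p \<in> K \<Longrightarrow> norm p \<le> R" "R > 0"
    using compact_imp_bounded[OF K(1)] unfolding bounded_pos by auto
  show ?thesis
  proof (rule that[of \<eta> W V R])
    show "(\<eta> has_derivative (\<lambda>(a, b). W p * a + V p * b)) (at p)" for p
      using \<eta>D[of p] unfolding Deq .
    show "continuous_on UNIV V" "continuous_on UNIV W"
      unfolding V_def W_def by (rule contD)+
    show "R > 0" by fact
    fix x t :: real
    show "\<eta> (x, t) = 0 \<and> V (x, t) = 0 \<and> W (x, t) = 0" if "\<not> (\<bar>x\<bar> \<le> R \<and> 0 < t \<and> t \<le> R)"
    proof -
      have "(x, t) \<notin> K"
      proof
        assume *: "(x, t) \<in> K"
        then have "t > 0" using K(2) by auto
        then show False using R(1)[OF *] norm_fst_le[of x t] norm_snd_le[of t x] that by auto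
      qed
      then show ?thesis by (simp add: \<eta>0 V_def W_def D2)
    qed
    assume t: "t > 0"
    have "((\<lambda>y. \<eta> (y, t)) has_derivative (\<lambda>a. D (x, t) (a, 0))) (at x)"
      by (rule has_derivative_compose[OF _ \<eta>D, of "\<lambda>y. (y, t)"]) (auto intro!: derivative_eq_intros)
    then have "((\<lambda>y. \<eta> (y, t)) has_real_derivative W (x, t)) (at x)"
      by (simp add: D has_field_derivative_def)
    moreover have "(\<lambda>y. \<eta> (y, t)) = (\<lambda>y. \<psi> (y, t))" using t U(4) by (auto simp: \<eta>_def)
    ultimately show "d_x \<psi> (x, t) = W (x, t)" by (simp add: d_x_def DERIV_imp_deriv)
    have "((\<lambda>s. \<eta> (x, s)) has_derivative (\<lambda>b. D (x, t) (0, b))) (at t)"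
      by (rule has_derivative_compose[OF _ \<eta>D, of "\<lambda>s. (x, s)"]) (auto intro!: derivative_eq_intros)
    then have "((\<lambda>s. \<eta> (x, s)) has_real_derivative V (x, t)) (at t)"
      by (simp add: D has_field_derivative_def)
    then have "((\<lambda>s. \<psi> (x, s)) has_real_derivative V (x, t)) (at t)"
      by (rule has_field_derivative_transform_within_open[of _ _ _ "{0<..}"])
        (use t U(4) in \<open>auto simp: \<eta>_def\<close>)
    then show "d_t \<psi> (x, t) = V (x, t)" by (simp add: d_t_def DERIV_imp_deriv)
  qed
qed

text \<open>One law with density \<open>q\<close> and flux \<open>Q\<close> covers both transport
  equations. The step parts produce the Rankine-Hugoniot deficit times the integral of the test
  function along \<open>S\<close>; the linearly growing weight produces the opposite amount.\<close>

lemma step_delta_conservation_law: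
  assumes \<psi>: "test_function_on open_half_plane \<psi>"
    and w: "\<And>t. w t = t / sqrt (1 + \<sigma>\<^sup>2) * (\<sigma> * (q_p - q_m) - (Q_p - Q_m))"
  shows "step_delta_pairing \<sigma> q_m q_p w (d_t \<psi>) +
    step_delta_pairing \<sigma> Q_m Q_p (\<lambda>t. \<sigma> * w t) (d_x \<psi>) = 0"
proof -
  obtain \<eta> V W :: "real \<times> real \<Rightarrow> real" and R where
    \<eta>: "\<And>p. (\<eta> has_derivative (\<lambda>(a, b). W p * a + V p * b)) (at p)"
    and cont: "continuous_on UNIV V" "continuous_on UNIV W" and R: "R > 0"
    and supp: "\<And>x t. \<not> (\<bar>x\<bar> \<le> R \<and> 0 < t \<and> t \<le> R) \<Longrightarrow> \<eta> (x, t) = 0 \<and> V (x, t) = 0 \<and> W (x, t) = 0"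
    and dx: "\<And>x t. t > 0 \<Longrightarrow> d_x \<psi> (x, t) = W (x, t)"
    and dt: "\<And>x t. t > 0 \<Longrightarrow> d_t \<psi> (x, t) = V (x, t)"
    by (rule test_function_openE[OF \<psi>]) (rule that)
  \<comment> \<open>In the coordinates \<open>(y, t)\<close> with \<open>y = x - \<sigma> t\<close> the curve \<open>S\<close> becomes \<open>y = 0\<close>.\<close>
  define h hy ht where "h y t = \<eta> (y + \<sigma> * t, t)" and "hy y t = W (y + \<sigma> * t, t)"
    and "ht y t = V (y + \<sigma> * t, t) + \<sigma> * W (y + \<sigma> * t, t)" for y t
  \<comment> \<open>On the support \<open>y = x - \<sigma> * t\<close> with
    \<open>\<bar>x\<bar> \<le> R\<close> and \<open>0 < t \<le> R\<close>.\<close>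
  define R' where "R' = R + \<bar>\<sigma>\<bar> * R"
  have R': "R \<le> R'" "0 < R'" using R by (auto simp: R'_def intro: add_pos_nonneg)
  have zero: "h y t = 0 \<and> hy y t = 0 \<and> ht y t = 0" if "\<not> (\<bar>y\<bar> \<le> R' \<and> \<bar>t\<bar> \<le> R')" for y t
  proof -
    have "\<not> (\<bar>y + \<sigma> * t\<bar> \<le> R \<and> 0 < t \<and> t \<le> R)"
    proof
      assume *: "\<bar>y + \<sigma> * t\<bar> \<le> R \<and> 0 < t \<and> t \<le> R"
      then have "\<bar>\<sigma> * t\<bar> \<le> \<bar>\<sigma>\<bar> * R" by (auto simp: abs_mult intro!: mult_left_mono)
      with * that R' show False by (auto simp: R'_def)
    qed
    from supp[OF this] show ?thesis by (auto simp: h_def hy_def ht_def)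
  qed
  have h_y: "((\<lambda>y. h y t) has_real_derivative hy y t) (at y)" for y t
  proof -
    have "((\<lambda>y. \<eta> (y + \<sigma> * t, t)) has_derivative
        (\<lambda>a. (\<lambda>(a, b). W (y + \<sigma> * t, t) * a + V (y + \<sigma> * t, t) * b) (a, 0))) (at y)"
      by (rule has_derivative_compose[OF _ \<eta>, of "\<lambda>y. (y + \<sigma> * t, t)"])
        (auto intro!: derivative_eq_intros)
    then show ?thesis by (simp add: h_def hy_def has_field_derivative_def)
  qed
  have h_t: "((\<lambda>t. h y t) has_real_derivative ht y t) (at t)" for y t
  proof -
    have "((\<lambda>t. \<eta> (y + \<sigma> * t, t)) has_derivative
        (\<lambda>b. (\<lambda>(a, b). W (y + \<sigma> * t, t) * a + V (y + \<sigma> * t, t) * b) (\<sigma> * b, b))) (at t)"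
      by (rule has_derivative_compose[OF _ \<eta>, of "\<lambda>t. (y + \<sigma> * t, t)"])
        (auto intro!: derivative_eq_intros)
    then show ?thesis
      unfolding h_def ht_def has_field_derivative_def
      by (rule has_derivative_eq_rhs) (auto simp: algebra_simps)
  qed
  have cy: "continuous_on UNIV (\<lambda>p. hy (fst p) (snd p))"
    unfolding hy_def by (intro continuous_on_compose2[OF cont(2)] continuous_intros) auto
  have ct: "continuous_on UNIV (\<lambda>p. ht (fst p) (snd p))"
    unfolding ht_def
    by (intro continuous_intros continuous_on_compose2[OF cont(1)] continuous_on_compose2[OF cont(2)]) auto
  have cty: "continuous_on UNIV (\<lambda>t. ht y t)" for y
    using continuous_on_compose2[OF ct, of UNIV "\<lambda>t. (y, t)"] by (simp add: continuous_intros)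
  have cyt: "continuous_on UNIV (\<lambda>y. hy y t)" "continuous_on UNIV (\<lambda>y. ht y t)" for t
    using continuous_on_compose2[OF cy, of UNIV "\<lambda>y. (y, t)"]
      continuous_on_compose2[OF ct, of UNIV "\<lambda>y. (y, t)"] by (simp_all add: continuous_intros)
  have ch: "continuous_on UNIV (\<lambda>t. h y t)" for y
    using DERIV_isCont[OF h_t] by (auto simp: continuous_on_eq_continuous_at)
  define L where "L = (LINT t|lborel. h 0 t)"
  have stepW: "(LINT y|lborel. step_fun a b y * hy y t) = - (b - a) * h 0 t" for a b t
    by (rule integral_deriv_compact_support[where F = "\<lambda>y. h y t" and R = R'])
      (use h_y cyt zero in auto)
  have int_t0: "(LINT t|lborel. ht y t) = 0" for y
    by (rule integral_deriv_compact_support[where F = "\<lambda>t. h y t" and R = R'])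
      (use h_t cty zero in auto)
  have shift: "(LINT x|lborel. step_fun a b (x - \<sigma> * t) * G (x, t)) =
      (LINT y|lborel. step_fun a b y * G (y + \<sigma> * t, t))" for a b t and G :: "real \<times> real \<Rightarrow> real"
    using lborel_integral_real_affine[of 1 "\<lambda>x. step_fun a b (x - \<sigma> * t) * G (x, t)" "\<sigma> * t"]
    by (simp add: add.commute)
  have pair: "fun_pairing (\<lambda>(x, t). step_fun a b (x - \<sigma> * t)) d =
      (LINT t|lborel. LINT y|lborel. step_fun a b y * G (y + \<sigma> * t, t))"
    if "\<And>x t. t > 0 \<Longrightarrow> d (x, t) = G (x, t)" "\<And>x t. t \<le> 0 \<Longrightarrow> G (x, t) = 0"
    for a b d and G :: "real \<times> real \<Rightarrow> real"
    unfolding fun_pairing_def set_lebesgue_integral_def shift[symmetric]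
    by (intro Bochner_Integration.integral_cong refl) (use that in \<open>auto simp: indicator_def\<close>)
  have FW: "fun_pairing (\<lambda>(x, t). step_fun a b (x - \<sigma> * t)) (d_x \<psi>) = - (b - a) * L" for a b
  proof -
    have "fun_pairing (\<lambda>(x, t). step_fun a b (x - \<sigma> * t)) (d_x \<psi>) =
        (LINT t|lborel. LINT y|lborel. step_fun a b y * hy y t)"
      unfolding hy_def by (rule pair) (use dx supp in auto)
    then show ?thesis by (simp add: stepW L_def)
  qed
  have meas_step: "step_fun a b \<in> borel_measurable borel" for a b
    unfolding step_fun_def[abs_def] Heaviside_def[abs_def] by measurable
  have bstep: "\<bar>step_fun a b y\<bar> \<le> max \<bar>a\<bar> \<bar>b\<bar>" for a b y
    by (auto simp: step_fun_def Heaviside_def)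
  \<comment> \<open>In the moving coordinates \<open>V\<close> is \<open>ht\<close> minus \<sigma>
    times \<open>hy\<close>. The \<open>hy\<close> part is known from \<open>stepW\<close>; the
    \<open>ht\<close> part vanishes after exchanging the integrals, since the step depends on
    \<open>y\<close> only and \<open>int_t0\<close> applies for each fixed \<open>y\<close>.\<close>
  have FV: "fun_pairing (\<lambda>(x, t). step_fun a b (x - \<sigma> * t)) (d_t \<psi>) = \<sigma> * (b - a) * L" for a b
  proof -
    note [measurable] = meas_step
    have int: "integrable lborel (\<lambda>y. step_fun a b y * k y t)"
      if k: "k = hy \<or> k = ht" for k t
    proof -
      have k0: "k y t = 0" if "\<bar>y\<bar> > R'" for y using zero[of y t] k that by auto
      have ck: "continuous_on UNIV (\<lambda>y. k y t)" using k cyt by auto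
      have "integrable lborel (\<lambda>y. indicator {-R'..R'} y *\<^sub>R k y t)"
        using continuous_on_subset[OF ck] by (intro borel_integrable_compact) auto
      then show ?thesis
      proof (rule Bochner_Integration.integrable_bound[OF integrable_mult_right[of "max \<bar>a\<bar> \<bar>b\<bar>"]])
        show "(\<lambda>y. step_fun a b y * k y t) \<in> borel_measurable lborel"
          using borel_measurable_continuous_onI[OF ck] by measurable
        show "AE y in lborel. norm (step_fun a b y * k y t)
            \<le> norm (max \<bar>a\<bar> \<bar>b\<bar> * (indicator {-R'..R'} y *\<^sub>R k y t))"
          using k0 bstep by (intro AE_I2) (auto simp: indicator_def abs_mult intro!: mult_right_mono)
      qed
    qed
    \<comment> \<open>A box containing the support of \<open>ht\<close>; it provides the joint
      integrability behind the exchange.\<close>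
    let ?B = "cbox (-R', -R') (R', R') :: (real \<times> real) set"
    have "integrable lborel (\<lambda>p. indicator ?B p *\<^sub>R ht (fst p) (snd p))"
      using continuous_on_subset[OF ct] by (intro borel_integrable_compact) auto
    then have I: "integrable lborel (\<lambda>p. step_fun a b (fst p) * ht (fst p) (snd p))"
    proof (rule Bochner_Integration.integrable_bound[OF integrable_mult_right[of "max \<bar>a\<bar> \<bar>b\<bar>"]])
      have "(\<lambda>p. step_fun a b (fst p)) \<in> borel_measurable (borel :: (real \<times> real) measure)"
        unfolding borel_prod[symmetric] by measurable
      then show "(\<lambda>p. step_fun a b (fst p) * ht (fst p) (snd p)) \<in> borel_measurable lborel"
        using borel_measurable_continuous_onI[OF ct] by simp
      have "\<bar>step_fun a b x * ht x t\<bar> \<le> max \<bar>a\<bar> \<bar>b\<bar> * \<bar>indicator ?B (x, t) * ht x t\<bar>" for x t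
      proof (cases "(x, t) \<in> ?B")
        case True
        then show ?thesis using bstep[of a b x] by (simp add: abs_mult mult_right_mono)
      next
        case False
        then have "\<not> (\<bar>x\<bar> \<le> R' \<and> \<bar>t\<bar> \<le> R')" by (auto simp: cbox_Pair_eq)
        then have "ht x t = 0" using zero by blast
        then show ?thesis by simp
      qed
      then show "AE p in lborel. norm (step_fun a b (fst p) * ht (fst p) (snd p))
          \<le> norm (max \<bar>a\<bar> \<bar>b\<bar> * (indicator ?B p *\<^sub>R ht (fst p) (snd p)))"
        by (intro AE_I2) (auto simp: abs_mult)
    qed
    then have I': "integrable (lborel \<Otimes>\<^sub>M lborel) (\<lambda>(x, y). step_fun a b x * ht x y)"
      by (simp add: lborel_prod case_prod_beta')
    have "fun_pairing (\<lambda>(x, t). step_fun a b (x - \<sigma> * t)) (d_t \<psi>) =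
        (LINT t|lborel. LINT y|lborel. step_fun a b y * V (y + \<sigma> * t, t))"
      by (rule pair) (use dt supp in auto)
    also have "\<dots> = (LINT t|lborel. (LINT y|lborel. step_fun a b y * ht y t) + \<sigma> * (b - a) * h 0 t)"
    proof (intro Bochner_Integration.integral_cong refl)
      fix t
      have "(LINT y|lborel. step_fun a b y * V (y + \<sigma> * t, t)) =
          (LINT y|lborel. step_fun a b y * ht y t - \<sigma> * (step_fun a b y * hy y t))"
        by (intro Bochner_Integration.integral_cong refl) (simp add: ht_def hy_def algebra_simps)
      also have "\<dots> = (LINT y|lborel. step_fun a b y * ht y t) - \<sigma> * (LINT y|lborel. step_fun a b y * hy y t)"
        using int[of ht t] int[of hy t] by simp
      finally show "(LINT y|lborel. step_fun a b y * V (y + \<sigma> * t, t)) =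
          (LINT y|lborel. step_fun a b y * ht y t) + \<sigma> * (b - a) * h 0 t"
        by (simp only: stepW)
    qed
    also have "\<dots> = (LINT t|lborel. LINT y|lborel. step_fun a b y * ht y t) + \<sigma> * (b - a) * L"
    proof -
      have "integrable lborel (\<lambda>t. LINT y|lborel. step_fun a b y * ht y t)"
        using lborel_pair.integrable_snd[OF I'] .
      moreover have "integrable lborel (\<lambda>t. h 0 t)"
      proof -
        have "integrable lborel (\<lambda>t. indicator {-R'..R'} t *\<^sub>R h 0 t)"
          using continuous_on_subset[OF ch] by (intro borel_integrable_compact) auto
        moreover have "indicator {-R'..R'} t *\<^sub>R h 0 t = h 0 t" for t
          using zero[of 0 t] by (cases "\<bar>t\<bar> \<le> R'") (auto simp: indicator_def)
        ultimately show ?thesis by (simp only:)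
      qed
      ultimately show ?thesis by (simp add: L_def)
    qed
    also have "(LINT t|lborel. LINT y|lborel. step_fun a b y * ht y t) =
        (LINT y|lborel. LINT t|lborel. step_fun a b y * ht y t)"
      using lborel_pair.Fubini_integral[OF I'] .
    also have "\<dots> = 0" by (simp add: int_t0)
    finally show ?thesis by simp
  qed
  define c where "c = \<sigma> * (q_p - q_m) - (Q_p - Q_m)"
  \<comment> \<open>The factor \<open>z\<close> is 1 for the density weight and \<sigma> for the
    flux weight.\<close>
  have delta: "delta_pairing {0..} (\<lambda>t. \<sigma> * t) (\<lambda>t. t) (\<lambda>t. z * w t) d = z * c * (LINT t|lborel. t * G (\<sigma> * t, t))"
    if "\<And>x t. t > 0 \<Longrightarrow> d (x, t) = G (x, t)" "\<And>x t. t \<le> 0 \<Longrightarrow> G (x, t) = 0"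
    for z d and G :: "real \<times> real \<Rightarrow> real"
  proof -
    have "sqrt (1 + \<sigma>\<^sup>2) > 0" by (simp add: add_pos_nonneg)
    then have "indicator {0..} t *\<^sub>R (z * w t * d (\<sigma> * t, t) * sqrt ((deriv (\<lambda>t. \<sigma> * t) t)\<^sup>2 + (deriv (\<lambda>t. t) t)\<^sup>2)) =
        z * c * (t * G (\<sigma> * t, t))" for t
      using that[of t "\<sigma> * t"] by (cases "t > 0") (auto simp: indicator_def w c_def add.commute)
    then show ?thesis unfolding delta_pairing_def set_lebesgue_integral_def
      by (simp only: integral_mult_right_zero)
  qed
  \<comment> \<open>Along \<open>S\<close> the combination is \<open>t\<close> times the total time
    derivative \<open>ht 0 t\<close>, and the integral of the derivative of \<open>t * h 0 t\<close>
    is 0.\<close>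
  have G: "(LINT t|lborel. t * V (\<sigma> * t, t)) + \<sigma> * (LINT t|lborel. t * W (\<sigma> * t, t)) = - L"
  proof -
    have c1: "continuous_on UNIV (\<lambda>t. t * V (\<sigma> * t, t))" "continuous_on UNIV (\<lambda>t. t * W (\<sigma> * t, t))"
      by (intro continuous_intros continuous_on_compose2[OF cont(1)] continuous_on_compose2[OF cont(2)]; simp)+
    have int: "integrable lborel f"
      if "continuous_on UNIV f" "\<And>t. \<not> (0 < t \<and> t \<le> R) \<Longrightarrow> f t = 0" for f :: "real \<Rightarrow> real"
    proof -
      have "integrable lborel (\<lambda>t. indicator {0..R} t *\<^sub>R f t)"
        using continuous_on_subset[OF that(1)] by (intro borel_integrable_compact) auto
      moreover have "indicator {0..R} t *\<^sub>R f t = f t" for t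
        using that(2)[of t] by (cases "0 < t \<and> t \<le> R") (auto simp: indicator_def)
      ultimately show ?thesis by (simp only:)
    qed
    have i1: "integrable lborel (\<lambda>t. t * V (\<sigma> * t, t))" "integrable lborel (\<lambda>t. t * W (\<sigma> * t, t))"
        "integrable lborel (\<lambda>t. h 0 t)"
      by (rule int; use c1 ch[of 0] supp in \<open>auto simp: h_def\<close>)+
    have "(LINT t|lborel. h 0 t + t * ht 0 t) = 0"
    proof (rule integral_deriv_compact_support[where F = "\<lambda>t. t * h 0 t" and R = R'])
      show "((\<lambda>t. t * h 0 t) has_real_derivative h 0 t + t * ht 0 t) (at t)" for t
        by (auto intro!: derivative_eq_intros h_t simp: algebra_simps)
      show "continuous_on UNIV (\<lambda>t. h 0 t + t * ht 0 t)"
        by (intro continuous_intros ch cty)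
    qed (use zero in auto)
    also have "(\<lambda>t. h 0 t + t * ht 0 t) = (\<lambda>t. h 0 t + (t * V (\<sigma> * t, t) + \<sigma> * (t * W (\<sigma> * t, t))))"
      by (simp add: ht_def algebra_simps)
    finally show ?thesis using i1 by (simp add: L_def)
  qed
  have dV: "delta_pairing {0..} (\<lambda>t. \<sigma> * t) (\<lambda>t. t) w (d_t \<psi>) = c * (LINT t|lborel. t * V (\<sigma> * t, t))"
    using delta[of "d_t \<psi>" V 1] dt supp by simp
  have dW: "delta_pairing {0..} (\<lambda>t. \<sigma> * t) (\<lambda>t. t) (\<lambda>t. \<sigma> * w t) (d_x \<psi>) =
      \<sigma> * c * (LINT t|lborel. t * W (\<sigma> * t, t))"
    using delta[of "d_x \<psi>" W \<sigma>] dx supp by simp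
  \<comment> \<open>The step parts contribute \<open>c * L\<close> and, by \<open>G\<close>, the
    delta parts \<open>- c * L\<close>.\<close>
  have "step_delta_pairing \<sigma> q_m q_p w (d_t \<psi>) +
      step_delta_pairing \<sigma> Q_m Q_p (\<lambda>t. \<sigma> * w t) (d_x \<psi>) =
      (\<sigma> * (q_p - q_m) - (Q_p - Q_m)) * L +
      c * ((LINT t|lborel. t * V (\<sigma> * t, t)) + \<sigma> * (LINT t|lborel. t * W (\<sigma> * t, t)))"
    unfolding step_delta_pairing_def FV FW dV dW by algebra
  then show ?thesis unfolding G c_def by simp
qed

section \<open>From sequences of parameters to the limit, and the delta shock equations\<close>

theorem theorem4p1:
  fixes n \<alpha> rho_m u_m rho_p u_p \<sigma> :: real
    and w1 w2 :: "real \<Rightarrow> real"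
    and rho u :: "real \<Rightarrow> real \<Rightarrow> real \<times> real \<Rightarrow> real"
  assumes "1 \<le> n" "n \<le> 3" and "0 < \<alpha>" "\<alpha> \<le> 1"
    and "rho_m > 0" "rho_p > 0" and "u_m > u_p"
    and two_shock: "\<And>A B. A > 0 \<Longrightarrow> B > 0 \<Longrightarrow>
           (rho_p, u_p) \<in> S1S2_region n \<alpha> A B rho_m u_m \<Longrightarrow>
           is_two_shock_solution n \<alpha> A B rho_m u_m rho_p u_p (rho A B) (u A B)"
    and "\<sigma> = sigma_delta rho_m u_m rho_p u_p"
    and "\<And>t. w1 t = t / sqrt (1 + \<sigma>\<^sup>2) *
           (\<sigma> * (rho_p - rho_m) - (rho_p * u_p - rho_m * u_m))"
    and "\<And>t. w2 t = t / sqrt (1 + \<sigma>\<^sup>2) *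
           (\<sigma> * (rho_p * u_p - rho_m * u_m) - (rho_p * u_p\<^sup>2 - rho_m * u_m\<^sup>2))"
  shows "(\<forall>\<phi>. test_function_on closed_half_plane \<phi> \<longrightarrow>
            ((\<lambda>(A, B). fun_pairing (rho A B) \<phi>) \<longlongrightarrow>
               step_delta_pairing \<sigma> rho_m rho_p w1 \<phi>)
              (at (0, 0) within {0<..} \<times> {0<..}) \<and>
            ((\<lambda>(A, B). fun_pairing (\<lambda>p. rho A B p * u A B p) \<phi>) \<longlongrightarrow>
               step_delta_pairing \<sigma> (rho_m * u_m) (rho_p * u_p) w2 \<phi>)
              (at (0, 0) within {0<..} \<times> {0<..})) \<and>
         is_delta_shock_solution rho_m u_m rho_p u_p \<sigma> \<sigma> w1 w2"
proof -
  define m where "m = \<sigma> * (rho_p - rho_m) - (rho_p * u_p - rho_m * u_m)"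
  have w1: "w1 t = t / sqrt (1 + \<sigma>\<^sup>2) * m" for t using assms(10) by (simp add: m_def)
  have quad: "\<sigma> * m = \<sigma> * (rho_p * u_p - rho_m * u_m) - (rho_p * u_p\<^sup>2 - rho_m * u_m\<^sup>2)"
    unfolding m_def by (rule sigma_delta_quadratic) (use assms in auto)
  have w2: "w2 t = t / sqrt (1 + \<sigma>\<^sup>2) * (\<sigma> * m)" for t using assms(11) quad by simp
  have "(\<lambda>k. fun_pairing (rho (fst (X k)) (snd (X k))) \<phi>) \<longlonglongrightarrow> step_delta_pairing \<sigma> rho_m rho_p w1 \<phi> \<and>
      (\<lambda>k. fun_pairing (\<lambda>p. rho (fst (X k)) (snd (X k)) p * u (fst (X k)) (snd (X k)) p) \<phi>)
        \<longlonglongrightarrow> step_delta_pairing \<sigma> (rho_m * u_m) (rho_p * u_p) w2 \<phi>"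
    if \<phi>: "test_function_on closed_half_plane \<phi>"
      and X: "\<forall>k. X k \<in> {0<..} \<times> {0<..} - {(0, 0)}" "X \<longlonglongrightarrow> (0, 0)" for \<phi> and X :: "nat \<Rightarrow> real \<times> real"
  proof -
    have X': "fst (X k) > 0" "snd (X k) > 0" for k using X(1) by (auto simp: mem_Times_iff)
    have lim: "(\<lambda>k. fst (X k)) \<longlonglongrightarrow> 0" "(\<lambda>k. snd (X k)) \<longlonglongrightarrow> 0"
      using tendsto_fst[OF X(2)] tendsto_snd[OF X(2)] by auto
    \<comment> \<open>\<open>shock_Phi\<close> is continuous in \<open>A\<close> and
      \<open>B\<close> and vanishes when both are 0, so \<open>u_m > u_p\<close> puts the right
      state into the two-shock region for all late indices.\<close>
    have "(\<lambda>k. shock_Phi n \<alpha> (fst (X k)) (snd (X k)) rho_p rho_m) \<longlonglongrightarrow> shock_Phi n \<alpha> 0 0 rho_p rho_m"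
      unfolding shock_Phi_def by (intro tendsto_intros lim)
    then have "\<forall>\<^sub>F k in sequentially. shock_Phi n \<alpha> (fst (X k)) (snd (X k)) rho_p rho_m < u_m - u_p"
      using assms by (intro order_tendstoD(2)) (auto simp: shock_Phi_def)
    then obtain N where N: "\<And>k. k \<ge> N \<Longrightarrow> shock_Phi n \<alpha> (fst (X k)) (snd (X k)) rho_p rho_m < u_m - u_p"
      unfolding eventually_sequentially by blast
    \<comment> \<open>Dropping the first \<open>N\<close> terms makes the region condition hold for
      every index; \<open>LIMSEQ_offset\<close> undoes the shift at the end.\<close>
    define A B where "A k = fst (X (k + N))" and "B k = snd (X (k + N))" for k
    have A: "\<And>k. A k > 0" "A \<longlonglongrightarrow> 0" and B: "\<And>k. B k > 0" "B \<longlonglongrightarrow> 0"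
      using X' LIMSEQ_ignore_initial_segment[OF lim(1), of N] LIMSEQ_ignore_initial_segment[OF lim(2), of N]
      by (auto simp: A_def[abs_def] B_def[abs_def])
    have "is_two_shock_solution n \<alpha> (A k) (B k) rho_m u_m rho_p u_p (rho (A k) (B k)) (u (A k) (B k))" for k
      using N[of "k + N"] assms(6) by (intro two_shock A B) (auto simp: S1S2_region_def A_def B_def)
    then have "\<forall>k. \<exists>rs us. is_intermediate_state n \<alpha> (A k) (B k) rho_m u_m rho_p u_p rs us \<and>
        (\<forall>x t. t > 0 \<longrightarrow>
          (x / t < shock_speed rho_m u_m rs us \<longrightarrow>
            rho (A k) (B k) (x, t) = rho_m \<and> u (A k) (B k) (x, t) = u_m) \<and>
          (shock_speed rho_m u_m rs us < x / t \<and> x / t < shock_speed rs us rho_p u_p \<longrightarrow>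
            rho (A k) (B k) (x, t) = rs \<and> u (A k) (B k) (x, t) = us) \<and>
          (shock_speed rs us rho_p u_p < x / t \<longrightarrow>
            rho (A k) (B k) (x, t) = rho_p \<and> u (A k) (B k) (x, t) = u_p))"
      unfolding is_two_shock_solution_def Let_def by blast
    then obtain rs us where s: "\<And>k. is_intermediate_state n \<alpha> (A k) (B k) rho_m u_m rho_p u_p (rs k) (us k)"
      and sol: "\<And>k x t. t > 0 \<Longrightarrow> x / t < shock_speed rho_m u_m (rs k) (us k) \<Longrightarrow>
            rho (A k) (B k) (x, t) = rho_m \<and> u (A k) (B k) (x, t) = u_m"
        "\<And>k x t. t > 0 \<Longrightarrow> shock_speed rho_m u_m (rs k) (us k) < x / t \<Longrightarrow>
            x / t < shock_speed (rs k) (us k) rho_p u_p \<Longrightarrow>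
            rho (A k) (B k) (x, t) = rs k \<and> u (A k) (B k) (x, t) = us k"
        "\<And>k x t. t > 0 \<Longrightarrow> shock_speed (rs k) (us k) rho_p u_p < x / t \<Longrightarrow>
            rho (A k) (B k) (x, t) = rho_p \<and> u (A k) (B k) (x, t) = u_p"
      by metis
    note asym = assms(1,3,5-7) A B s
    define s1 s2 where "s1 k = shock_speed rho_m u_m (rs k) (us k)"
      and "s2 k = shock_speed (rs k) (us k) rho_p u_p" for k
    note sol = sol[folded s1_def s2_def]
    have lt: "s1 k < s2 k" for k
      using shock_speed_order[OF asym, of k] by (simp add: s1_def s2_def)
    have slim: "s1 \<longlonglongrightarrow> \<sigma>" "s2 \<longlonglongrightarrow> \<sigma>"
      using shock_speed_tendsto[OF asym] assms(9) by (auto simp: s1_def[abs_def] s2_def[abs_def])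
    have mass: "(\<lambda>k. rs k * (s2 k - s1 k)) \<longlonglongrightarrow> m"
      using intermediate_mass_tendsto[OF asym] assms(9) by (simp add: s1_def s2_def m_def)
    have "us \<longlonglongrightarrow> \<sigma>" using intermediate_velocity_tendsto[OF asym] assms(9) by simp
    \<comment> \<open>The momentum in the strip is its mass times \<open>us k\<close>; its limit
      \<open>\<sigma> * m\<close> is the coefficient in \<open>w2\<close> by
      \<open>quad\<close>.\<close>
    from tendsto_mult[OF this mass]
    have momentum: "(\<lambda>k. (rs k * us k) * (s2 k - s1 k)) \<longlonglongrightarrow> \<sigma> * m" by (simp add: mult_ac)
    have "(\<lambda>k. fun_pairing (rho (A k) (B k)) \<phi>) \<longlonglongrightarrow> step_delta_pairing \<sigma> rho_m rho_p w1 \<phi>"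
      by (rule fun_pairing_two_jumps_tendsto[OF \<phi> lt slim mass _ _ _ w1]) (use sol in auto)
    moreover have "(\<lambda>k. fun_pairing (\<lambda>p. rho (A k) (B k) p * u (A k) (B k) p) \<phi>)
        \<longlonglongrightarrow> step_delta_pairing \<sigma> (rho_m * u_m) (rho_p * u_p) w2 \<phi>"
      by (rule fun_pairing_two_jumps_tendsto[OF \<phi> lt slim momentum _ _ _ w2]) (use sol in auto)
    ultimately show ?thesis
      unfolding A_def B_def by (auto dest: LIMSEQ_offset)
  qed
  then have "\<forall>\<phi>. test_function_on closed_half_plane \<phi> \<longrightarrow>
      ((\<lambda>(A, B). fun_pairing (rho A B) \<phi>) \<longlongrightarrow> step_delta_pairing \<sigma> rho_m rho_p w1 \<phi>)
        (at (0, 0) within {0<..} \<times> {0<..}) \<and>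
      ((\<lambda>(A, B). fun_pairing (\<lambda>p. rho A B p * u A B p) \<phi>) \<longlongrightarrow>
         step_delta_pairing \<sigma> (rho_m * u_m) (rho_p * u_p) w2 \<phi>)
        (at (0, 0) within {0<..} \<times> {0<..})"
    unfolding tendsto_at_iff_sequentially comp_def case_prod_beta by blast
  moreover have "is_delta_shock_solution rho_m u_m rho_p u_p \<sigma> \<sigma> w1 w2"
  proof -
    \<comment> \<open>In the first equation the flux weight is \<open>w2\<close>, which must be
      \<sigma> times the density weight \<open>w1\<close>; in the second equation the flux weight
      already has this form.\<close>
    have w21: "w2 = (\<lambda>t. \<sigma> * w1 t)" by (simp add: w1 w2 fun_eq_iff)
    show ?thesis unfolding is_delta_shock_solution_def
    proof (intro conjI refl allI impI)
      fix \<psi> assume \<psi>: "test_function_on open_half_plane \<psi>"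
      show "step_delta_pairing \<sigma> rho_m rho_p w1 (d_t \<psi>) +
          step_delta_pairing \<sigma> (rho_m * u_m) (rho_p * u_p) w2 (d_x \<psi>) = 0"
        unfolding w21 by (rule step_delta_conservation_law[OF \<psi> assms(10)])
      show "step_delta_pairing \<sigma> (rho_m * u_m) (rho_p * u_p) w2 (d_t \<psi>) +
          step_delta_pairing \<sigma> (rho_m * u_m\<^sup>2) (rho_p * u_p\<^sup>2) (\<lambda>t. \<sigma> * w2 t) (d_x \<psi>) = 0"
        by (rule step_delta_conservation_law[OF \<psi> assms(11)])
    qed
  qed
  ultimately show ?thesis by blast
qed

end
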